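(* Let $C$ be a closed cone with nonempty interior $C^\circ$ in a finite dimensional real vector space $X$ and let $\varphi\in X^*$ be a strictly positive functional. Suppose that $f\colon C^\circ\to C^\circ$ is an order-preserving homogeneous mapping with no fixed point in $C^\circ$ and with partial spectral radius $r_{C^\circ}(f)=1$. Let $\Sigma_\varphi^\circ:=\{x\in C^\circ\colon \varphi(x)=1\}$ and let $g\colon \Sigma_\varphi^\circ\to\Sigma_\varphi^\circ$ be given by $g(x)=\frac{f(x)}{\varphi(f(x))}$. If there exists $x_0\in C^\circ$ such that either (a) $\mathcal{O}(x_0;f)$ has compact closure in the norm topology, or (b) $\lim_{k\to\infty}\|f^k(x_0)\|=\infty$, then there exists a convex set $\Omega\subseteq\partial\Sigma_\varphi^\circ$ such that for each $x\in\Sigma_\varphi^\circ$ the accumulation points of $\mathcal{O}(x;g)$ lie in $\Omega$.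
   Context: A cone $C\subseteq X$ is a convex set with $C\cap(-C)=\{0\}$ and $\lambda C\subseteq C$ for all $\lambda\ge 0$. It induces the partial order $x\le_C y$ iff $y-x\in C$. $X$ is equipped with any norm $\|\cdot\|$. A linear functional $\varphi$ is strictly positive if $\varphi(x)>0$ for all $x\in C\setminus\{0\}$. A map $f\colon C^\circ\to C^\circ$ is order-preserving if $x\le_C y$ implies $f(x)\le_C f(y)$, and homogeneous if $f(\lambda x)=\lambda f(x)$ for all $\lambda>0$ and $x\in C^\circ$. The partial spectral radius of such an $f$ is $r_{C^\circ}(f)=\lim_{k\to\infty}\|f^k\|_{C^\circ}^{1/k}$, where $\|f^k\|_{C^\circ}=\sup\{\|f^k(x)\|\colon x\in C^\circ,\ \|x\|\le 1\}$. For a self-map $h$, $\mathcal{O}(x;h)=\{h^k(x)\colon k\ge 0\}$ is the orbit of $x$; its accumulation points are the limits (in the norm topology) of subsequences $(h^{k_i}(x))_i$ with $k_i\to\infty$. $\partial\Sigma_\varphi^\circ$ is the boundary of $\Sigma_\varphi^\circ$ relative to the hyperplane $\{x\in X\colon\varphi(x)=1\}$, i.e. $\{x\in\partial C\colon\varphi(x)=1\}$. *)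

theory Defs
  imports "HOL-Analysis.Analysis"
begin

definition salient_cone :: "'a::real_vector set \<Rightarrow> bool" where
  "salient_cone C \<longleftrightarrow> convex C \<and> cone C \<and> C \<inter> uminus ` C = {0}"

definition cone_le :: "'a::real_vector set \<Rightarrow> 'a \<Rightarrow> 'a \<Rightarrow> bool" where
  "cone_le C x y \<longleftrightarrow> y - x \<in> C"

definition strictly_positive :: "'a::real_vector set \<Rightarrow> ('a \<Rightarrow> real) \<Rightarrow> bool" where
  "strictly_positive C \<phi> \<longleftrightarrow> linear \<phi> \<and> (\<forall>x\<in>C - {0}. \<phi> x > 0)"

definition order_preserving_on :: "'a::real_vector set \<Rightarrow> 'a set \<Rightarrow> ('a \<Rightarrow> 'a) \<Rightarrow> bool" where
  "order_preserving_on C S f \<longleftrightarrow> (\<forall>x\<in>S. \<forall>y\<in>S. cone_le C x y \<longrightarrow> cone_le C (f x) (f y))"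

definition homogeneous_on :: "'a::real_vector set \<Rightarrow> ('a \<Rightarrow> 'a) \<Rightarrow> bool" where
  "homogeneous_on S f \<longleftrightarrow> (\<forall>c>0. \<forall>x\<in>S. f (c *\<^sub>R x) = c *\<^sub>R f x)"

text \<open>For the iterates of an order-preserving homogeneous self-map of the interior of a closed
  cone in finite dimension, the supremum below is over a bounded set (closed cones are normal) and
  the sequence of these suprema is submultiplicative, so neither \<^const>\<open>Sup\<close> nor \<^const>\<open>lim\<close>
  takes an unspecified value.\<close>

definition interior_norm :: "'a::real_normed_vector set \<Rightarrow> ('a \<Rightarrow> 'a) \<Rightarrow> real" where
  "interior_norm C h = Sup {norm (h x) | x. x \<in> interior C \<and> norm x \<le> 1}"

definition partial_spectral_radius :: "'a::real_normed_vector set \<Rightarrow> ('a \<Rightarrow> 'a) \<Rightarrow> real" where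
  "partial_spectral_radius C f = lim (\<lambda>k. root k (interior_norm C (f ^^ k)))"

definition forward_orbit :: "('a \<Rightarrow> 'a) \<Rightarrow> 'a \<Rightarrow> 'a set" where
  "forward_orbit h x = {(h ^^ k) x | k. True}"

text \<open>Accumulation points are those of the sequence of iterates, not the limit points of the set
  \<^const>\<open>forward_orbit\<close>: a periodic orbit accumulates at each of its points.\<close>

definition orbit_accumulation_points ::
    "('a::topological_space \<Rightarrow> 'a) \<Rightarrow> 'a \<Rightarrow> 'a set" where
  "orbit_accumulation_points h x =
     {y. \<exists>k :: nat \<Rightarrow> nat. filterlim k at_top sequentially \<and> (\<lambda>i. (h ^^ k i) x) \<longlonglongrightarrow> y}"

definition open_slice :: "'a::real_normed_vector set \<Rightarrow> ('a \<Rightarrow> real) \<Rightarrow> 'a set" where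
  "open_slice C \<phi> = {x \<in> interior C. \<phi> x = 1}"

definition slice_boundary :: "'a::real_normed_vector set \<Rightarrow> ('a \<Rightarrow> real) \<Rightarrow> 'a set" where
  "slice_boundary C \<phi> = {x \<in> frontier C. \<phi> x = 1}"

definition normalized_map :: "('a::real_vector \<Rightarrow> real) \<Rightarrow> ('a \<Rightarrow> 'a) \<Rightarrow> 'a \<Rightarrow> 'a" where
  "normalized_map \<phi> f x = f x /\<^sub>R \<phi> (f x)"

end

theory Submission
  imports Defs
begin

text \<open>Write \<open>\<preceq>\<close> for the order of \<open>C\<close>, and fix \<open>u\<close> in the interior.  For
  \<open>l > 0\<close> there is an alternative (\<open>resolvent_or_growth\<close>): either the increasing sequence
  \<open>x\<^sub>0 = u\<close>, \<open>x\<^sub>n\<^sub>+\<^sub>1 = f x\<^sub>n / l + u\<close> is bounded and converges to an interior solution of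
  \<open>x = f x / l + u\<close>, which satisfies \<open>f x \<preceq> l x\<close>; or a limit of its normalised terms is a
  \<open>w \<noteq> 0\<close> in \<open>C\<close> with \<open>c l\<^sup>k w \<preceq> f\<^sup>k u\<close> for some \<open>c > 0\<close> and all \<open>k\<close>.  It follows that the
  partial spectral radius is a limit, equal to the infimum of those \<open>l\<close> for which some interior
  \<open>x\<close> has \<open>f x \<preceq> l x\<close>.  If this infimum is \<open>1\<close>, then all \<open>l > 1\<close> are in the first case, all
  \<open>l < 1\<close> in the second, and no orbit of \<open>f\<close> comes arbitrarily close to \<open>0\<close>.

  Suppose that an orbit of \<open>f\<close> is bounded; then all are.  The set of all \<open>y\<close> in the slice
  that lie below a whole orbit, \<open>y \<preceq> f\<^sup>k z\<close> for all \<open>k\<close>, is convex, because \<open>z\<^sub>1 + z\<^sub>2\<close> serves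
  for a convex combination if \<open>z\<^sub>1\<close> and \<open>z\<^sub>2\<close> serve for its two points.  It contains the
  accumulation points, since \<open>z\<close> may be chosen to dominate a multiple of the orbit of \<open>x\<close>.
  Were such a \<open>y\<close> interior, the orbit of \<open>z\<close> would satisfy \<open>c u \<preceq> f\<^sup>k z \<preceq> B u\<close>.  The
  solutions of \<open>x = (1 - t) f x + t u\<close> for \<open>0 < t < 1\<close>, multiples of the resolvent solutions
  above, then lie between \<open>(c / B) u\<close> and \<open>(B / c) u\<close>, and for \<open>t \<rightarrow> 0\<close> they accumulate at a
  fixed point of \<open>f\<close> in the interior (\<open>fixed_point_of_bounded_orbit\<close>).

  Suppose that an orbit of \<open>f\<close> tends to infinity in norm; then all do.  Take \<open>l\<^sub>n \<rightarrow> 1\<close> with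
  \<open>l\<^sub>n > 1\<close>, interior \<open>v\<^sub>n\<close> with \<open>f v\<^sub>n \<preceq> l\<^sub>n v\<^sub>n\<close>, and \<open>\<beta>\<^sub>n\<close> such that \<open>u \<preceq> \<beta>\<^sub>n v\<^sub>n\<close> but not
  \<open>u \<preceq> (\<beta>\<^sub>n / 2) v\<^sub>n\<close>.  The points \<open>y\<close> of the slice with \<open>y \<preceq> s \<beta>\<^sub>n v\<^sub>n\<close> for every \<open>s > 0\<close> and
  all large \<open>n\<close> form a convex set without interior points of \<open>C\<close>.  It
  contains the accumulation points because \<open>f\<^sup>k x \<preceq> M l\<^sub>n\<^sup>k \<beta>\<^sub>n v\<^sub>n\<close> and \<open>\<phi> (f\<^sup>k x) \<rightarrow> \<infinity>\<close>.\<close>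

section \<open>Preliminaries\<close>

text \<open>Finite dimension is given by a finite spanning set and not by a type class, so the
  sequential compactness of bounded sets is proved here, by induction on that set: the coefficient
  of a new basis vector is bounded because the vector has positive distance to the closed
  span of the others.\<close>

lemma bounded_seq_in_span_convergent_subseq:
  fixes B :: "'a::real_normed_vector set"
  assumes "finite B" and "\<And>n::nat. X n \<in> span B" and "\<And>n. norm (X n) \<le> R"
  shows "\<exists>l\<in>span B. \<exists>r. strict_mono r \<and> (\<lambda>n. X (r n)) \<longlonglongrightarrow> l"
  using assms
proof (induction B arbitrary: X R rule: finite_induct)
  case empty
  then have "X = (\<lambda>_. 0)" by auto
  then show ?case by (auto intro!: exI[of _ "id"] simp: strict_mono_def)
next
  case (insert b B)
  show ?case
  proof (cases "b \<in> span B")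
    case True
    then have "span (insert b B) = span B" by (simp add: span_redundant)
    then show ?thesis using insert.IH[of X R] insert.prems by simp
  next
    case False
    \<comment> \<open>The induction hypothesis makes the span of \<open>B\<close> closed.\<close>
    have "\<exists>d>0. \<forall>y\<in>span B. d \<le> norm (b - y)"
    proof (rule ccontr)
      assume "\<not> ?thesis"
      then have "\<forall>n. \<exists>y\<in>span B. norm (b - y) < inverse (real (Suc n))"
        by (meson inverse_positive_iff_positive not_le of_nat_0_less_iff zero_less_Suc)
      then obtain y where y: "\<And>n. y n \<in> span B" "\<And>n. norm (b - y n) < inverse (real (Suc n))"
        by metis
      have "(\<lambda>n. b - y n) \<longlonglongrightarrow> 0"
        by (rule Lim_null_comparison[OF _ LIMSEQ_inverse_real_of_nat])
          (use y(2) in \<open>auto intro!: always_eventually less_imp_le simp del: of_nat_Suc\<close>)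
      from tendsto_diff[OF tendsto_const[of b] this] have lim: "y \<longlonglongrightarrow> b" by simp
      then have "Bseq y" using convergentI convergent_imp_Bseq by blast
      then obtain R' where "\<And>n. norm (y n) \<le> R'" unfolding Bseq_def by blast
      with insert.IH[of y R'] y(1) obtain l r where
        "l \<in> span B" "strict_mono r" "(\<lambda>n. y (r n)) \<longlonglongrightarrow> l"
        by auto
      moreover have "(\<lambda>n. y (r n)) \<longlonglongrightarrow> b"
        using LIMSEQ_subseq_LIMSEQ[OF lim \<open>strict_mono r\<close>] by (simp add: o_def)
      ultimately show False using False LIMSEQ_unique by blast
    qed
    then obtain d where d: "d > 0" "\<And>y. y \<in> span B \<Longrightarrow> d \<le> norm (b - y)" by blast
    have "\<forall>n. \<exists>k. X n - k *\<^sub>R b \<in> span B"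
      using insert.prems(1) span_breakdown_eq by blast
    then obtain a where a: "\<And>n. X n - a n *\<^sub>R b \<in> span B" by metis
    have a_bd: "\<bar>a n\<bar> \<le> R / d" for n
    proof (cases "a n = 0")
      case True
      then show ?thesis using d(1) order_trans[OF norm_ge_zero insert.prems(2)[of n]] by simp
    next
      case False
      have "- (inverse (a n)) *\<^sub>R (X n - a n *\<^sub>R b) \<in> span B" using a by (intro span_scale)
      then have "d \<le> norm (b - (- inverse (a n)) *\<^sub>R (X n - a n *\<^sub>R b))" using d(2) by blast
      also have "b - (- inverse (a n)) *\<^sub>R (X n - a n *\<^sub>R b) = inverse (a n) *\<^sub>R X n"
        using False by (simp add: algebra_simps)
      finally have "d * \<bar>a n\<bar> \<le> norm (X n)" using False by (simp add: field_simps)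
      then show ?thesis using d(1) insert.prems(2)[of n] by (simp add: field_simps)
    qed
    have "bounded (range a)" using a_bd by (auto simp: bounded_iff)
    then obtain \<alpha> r where r: "strict_mono r" "(\<lambda>n. a (r n)) \<longlonglongrightarrow> \<alpha>"
      using bounded_imp_convergent_subsequence[of a] by (auto simp: o_def)
    have "norm (X (r n) - a (r n) *\<^sub>R b) \<le> R + R / d * norm b" for n
    proof -
      have "norm (X (r n) - a (r n) *\<^sub>R b) \<le> norm (X (r n)) + \<bar>a (r n)\<bar> * norm b"
        using norm_triangle_ineq4[of "X (r n)" "a (r n) *\<^sub>R b"] by simp
      also have "\<dots> \<le> R + R / d * norm b"
        by (intro add_mono insert.prems(2) mult_right_mono a_bd) auto
      finally show ?thesis .
    qed
    with insert.IH[of "\<lambda>n. X (r n) - a (r n) *\<^sub>R b" "R + R / d * norm b"] a obtain l s where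
      l: "l \<in> span B" "strict_mono s" "(\<lambda>n. X (r (s n)) - a (r (s n)) *\<^sub>R b) \<longlonglongrightarrow> l"
      by auto
    have "(\<lambda>n. a (r (s n))) \<longlonglongrightarrow> \<alpha>"
      using LIMSEQ_subseq_LIMSEQ[OF r(2) l(2)] by (simp add: o_def)
    from tendsto_add[OF l(3) tendsto_scaleR[OF this tendsto_const[of b]]]
    have "(\<lambda>n. X ((r \<circ> s) n)) \<longlonglongrightarrow> l + \<alpha> *\<^sub>R b" by simp
    moreover have "l + \<alpha> *\<^sub>R b \<in> span (insert b B)"
      using l(1) by (metis add_diff_cancel_right' span_breakdown_eq)
    moreover have "strict_mono (r \<circ> s)" using r(1) l(2) by (rule strict_mono_o)
    ultimately show ?thesis by blast
  qed
qed

lemma no_power_domination: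
  fixes a b :: real
  assumes "0 < c" "0 < a" "a < b"
  shows "\<exists>k. K * a ^ k < c * b ^ k"
proof -
  have "b / a > 1" using assms by simp
  from real_arch_pow[OF this, of "K / c"] obtain k where "K / c < (b / a) ^ k" by blast
  moreover have "a ^ k > 0" using assms by simp
  ultimately have "K * a ^ k < c * b ^ k"
    using assms(1) by (simp add: power_divide pos_less_divide_eq pos_divide_less_eq mult.commute)
  then show ?thesis by blast
qed

section \<open>The order of a closed cone with interior\<close>

text \<open>A closed salient cone in finite dimension with a strictly positive functional \<open>\<phi>\<close> and
  a chosen interior point \<open>u\<close>, the order unit.  The condition that \<open>0\<close> is not interior only excludes
  the space \<open>{0}\<close>.\<close>

locale order_unit_cone =
  fixes C :: "'a::real_normed_vector set" and \<phi> :: "'a \<Rightarrow> real" and u :: 'a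
  assumes findim: "\<exists>B :: 'a set. finite B \<and> span B = UNIV"
    and salient: "salient_cone C" and closed_C: "closed C"
    and strictly_pos: "strictly_positive C \<phi>"
    and u_interior: "u \<in> interior C" and zero_notin_interior: "0 \<notin> interior C"
begin

abbreviation le :: "'a \<Rightarrow> 'a \<Rightarrow> bool" (infix "\<preceq>" 50) where
  "x \<preceq> y \<equiv> cone_le C x y"

lemma zero_in_cone: "0 \<in> C"
  using salient by (auto simp: salient_cone_def)

lemma scale_in_cone: "x \<in> C \<Longrightarrow> 0 \<le> c \<Longrightarrow> c *\<^sub>R x \<in> C"
  using salient by (auto simp: salient_cone_def cone_def)

lemma add_in_cone: "x \<in> C \<Longrightarrow> y \<in> C \<Longrightarrow> x + y \<in> C"
  using salient convex_cone[of C] by (auto simp: salient_cone_def)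

lemma interior_in_cone: "x \<in> interior C \<Longrightarrow> x \<in> C"
  using interior_subset by blast

lemma le_refl: "x \<preceq> x"
  by (simp add: cone_le_def zero_in_cone)

lemma le_trans [trans]: "x \<preceq> y \<Longrightarrow> y \<preceq> z \<Longrightarrow> x \<preceq> z"
  using add_in_cone[of "y - x" "z - y"] by (simp add: cone_le_def)

lemma le_add: "x \<preceq> y \<Longrightarrow> x' \<preceq> y' \<Longrightarrow> x + x' \<preceq> y + y'"
  using add_in_cone[of "y - x" "y' - x'"] by (simp add: cone_le_def algebra_simps)

lemma le_antisym: "x \<preceq> y \<Longrightarrow> y \<preceq> x \<Longrightarrow> x = y"
proof -
  assume "x \<preceq> y" "y \<preceq> x"
  then have "y - x \<in> C" "x - y \<in> C" by (simp_all add: cone_le_def)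
  moreover from \<open>x - y \<in> C\<close> have "- (x - y) \<in> uminus ` C" by (rule imageI)
  ultimately have "y - x \<in> C \<inter> uminus ` C" by simp
  moreover have "C \<inter> uminus ` C = {0}" using salient by (simp add: salient_cone_def)
  ultimately have "y - x \<in> {0}" by (simp only:)
  then show "x = y" by simp
qed

lemma le_scale: "x \<preceq> y \<Longrightarrow> 0 \<le> c \<Longrightarrow> c *\<^sub>R x \<preceq> c *\<^sub>R y"
  using scale_in_cone[of "y - x" c] by (simp add: cone_le_def algebra_simps)

lemma le_scale_left: "x \<in> C \<Longrightarrow> a \<le> b \<Longrightarrow> a *\<^sub>R x \<preceq> b *\<^sub>R x"
  using scale_in_cone[of x "b - a"] by (simp add: cone_le_def algebra_simps)

lemma le_limit:
  assumes "X \<longlonglongrightarrow> x" "Y \<longlonglongrightarrow> y" "\<forall>\<^sub>F n in sequentially. X n \<preceq> Y n"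
  shows "x \<preceq> y"
  unfolding cone_le_def
  by (rule Lim_in_closed_set[OF closed_C _ _ tendsto_diff[OF assms(2,1)]])
    (use assms(3) in \<open>auto simp: cone_le_def\<close>)

lemma linear_phi: "linear \<phi>"
  using strictly_pos by (simp add: strictly_positive_def)

lemma phi_pos: "x \<in> C \<Longrightarrow> x \<noteq> 0 \<Longrightarrow> \<phi> x > 0"
  using strictly_pos by (simp add: strictly_positive_def)

lemma phi_nonneg: "x \<in> C \<Longrightarrow> \<phi> x \<ge> 0"
  using phi_pos[of x] linear_0[OF linear_phi] by fastforce

lemma phi_interior: "x \<in> interior C \<Longrightarrow> \<phi> x > 0"
  using phi_pos interior_in_cone zero_notin_interior by metis

lemma phi_mono: "x \<preceq> y \<Longrightarrow> \<phi> x \<le> \<phi> y"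
  using phi_nonneg[of "y - x"] by (simp add: cone_le_def linear_diff[OF linear_phi])

lemma phi_scale: "\<phi> (c *\<^sub>R x) = c * \<phi> x"
  using linear_scale[OF linear_phi] by simp

lemmas phi_add = linear_add[OF linear_phi]
lemmas phi_diff = linear_diff[OF linear_phi]

text \<open>Every interior point is an order unit, quantitatively.\<close>

lemma interior_dominates:
  assumes "x \<in> interior C"
  obtains K where "K > 0" "\<And>y. y \<preceq> (K * norm y) *\<^sub>R x"
proof -
  obtain e where e: "e > 0" "cball x e \<subseteq> C"
    using assms mem_interior_cball by metis
  have "y \<preceq> (1 / e * norm y) *\<^sub>R x" for y
  proof (cases "y = 0")
    case False
    have "x - (e / norm y) *\<^sub>R y \<in> C"
      using e False by (intro set_mp[OF e(2)]) (simp add: dist_norm)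
    from scale_in_cone[OF this, of "norm y / e"] show ?thesis
      using e False by (simp add: cone_le_def algebra_simps)
  qed (simp add: le_refl)
  with e show thesis by (intro that[of "1 / e"]) auto
qed

lemma interior_dominates_multiple:
  assumes "x \<in> interior C"
  obtains a where "a > 0" "a *\<^sub>R y \<preceq> x"
proof -
  obtain K where K: "K > 0" "\<And>y. y \<preceq> (K * norm y) *\<^sub>R x"
    using interior_dominates[OF assms] by blast
  let ?b = "K * norm y + 1"
  have "?b > 0" using K(1) by (simp add: add_nonneg_pos)
  moreover have "y \<preceq> ?b *\<^sub>R x"
    by (rule le_trans[OF K(2) le_scale_left]) (auto simp: assms interior_in_cone)
  then have "inverse ?b *\<^sub>R y \<preceq> inverse ?b *\<^sub>R (?b *\<^sub>R x)"
    using \<open>?b > 0\<close> by (intro le_scale) auto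
  ultimately show thesis by (intro that[of "inverse ?b"]) auto
qed

lemma interior_upward:
  assumes "x \<in> interior C" "x \<preceq> y"
  shows "y \<in> interior C"
proof -
  obtain e where e: "e > 0" "ball x e \<subseteq> C"
    using assms(1) mem_interior by metis
  have "ball y e \<subseteq> C"
  proof
    fix z assume "z \<in> ball y e"
    then have "z - (y - x) \<in> ball x e" by (simp add: dist_norm algebra_simps)
    with e have "z - (y - x) \<in> C" by blast
    from add_in_cone[OF this] assms(2) show "z \<in> C"
      by (metis cone_le_def diff_add_cancel)
  qed
  with e show ?thesis using mem_interior by blast
qed

lemma interior_scale:
  assumes "x \<in> interior C" "c > 0"
  shows "c *\<^sub>R x \<in> interior C"
proof -
  obtain e where e: "e > 0" "ball x e \<subseteq> C"
    using assms(1) mem_interior by metis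
  have "ball (c *\<^sub>R x) (c * e) \<subseteq> C"
  proof
    fix z assume z: "z \<in> ball (c *\<^sub>R x) (c * e)"
    have "x - inverse c *\<^sub>R z = inverse c *\<^sub>R (c *\<^sub>R x - z)"
      using assms(2) by (simp add: algebra_simps)
    with z have "inverse c *\<^sub>R z \<in> ball x e"
      using assms(2) by (simp add: dist_norm divide_simps mult.commute)
    with e have "inverse c *\<^sub>R z \<in> C" by blast
    from scale_in_cone[OF this, of c] assms(2) show "z \<in> C" by simp
  qed
  with e assms(2) show ?thesis using mem_interior by (metis mult_pos_pos)
qed

lemma interior_add: "x \<in> interior C \<Longrightarrow> y \<in> C \<Longrightarrow> x + y \<in> interior C"
  by (rule interior_upward[of x]) (auto simp: cone_le_def)

lemma phi_bounded:
  obtains K where "K > 0" "\<And>y. \<phi> y \<le> K * norm y"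
proof -
  obtain K where K: "K > 0" "\<And>y. y \<preceq> (K * norm y) *\<^sub>R u"
    using interior_dominates[OF u_interior] by blast
  have "\<phi> y \<le> (K * \<phi> u) * norm y" for y
    using phi_mono[OF K(2)[of y]] by (simp add: phi_scale mult_ac)
  with K phi_interior[OF u_interior] show thesis by (intro that[of "K * \<phi> u"]) auto
qed

lemma bounded_linear_phi: "bounded_linear \<phi>"
proof -
  obtain K where K: "K > 0" "\<And>y. \<phi> y \<le> K * norm y" using phi_bounded by blast
  have "norm (\<phi> y) \<le> norm y * K" for y
    using K(2)[of y] K(2)[of "- y"] linear_neg[OF linear_phi, of y] by (simp add: mult.commute)
  then show ?thesis
    using linear_phi by (simp add: bounded_linear_def bounded_linear_axioms_def) blast
qed

lemmas tendsto_phi = bounded_linear.tendsto[OF bounded_linear_phi]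

lemma bounded_seq_convergent_subseq:
  fixes X :: "nat \<Rightarrow> 'a"
  assumes "\<And>n. norm (X n) \<le> R"
  obtains l r where "strict_mono r" "(\<lambda>n. X (r n)) \<longlonglongrightarrow> l"
proof -
  obtain B :: "'a set" where "finite B" "span B = UNIV" using findim by blast
  with bounded_seq_in_span_convergent_subseq[of B X R] assms that show thesis by auto
qed

text \<open>Together with the monotonicity of \<open>\<phi>\<close> this gives normality of the cone: \<open>x \<preceq> y\<close> with
  \<open>x \<in> C\<close> bounds the norm of \<open>x\<close> by a multiple of \<open>\<phi> y\<close>.\<close>

lemma phi_coercive:
  obtains c where "c > 0" "\<And>y. y \<in> C \<Longrightarrow> norm y \<le> c * \<phi> y"
proof -
  have "\<exists>c>0. \<forall>y\<in>C. norm y \<le> c * \<phi> y"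
  proof (rule ccontr)
    assume "\<not> ?thesis"
    then have "\<forall>n. \<exists>y\<in>C. norm y > real (Suc n) * \<phi> y"
      by (metis not_le of_nat_0_less_iff zero_less_Suc)
    then obtain y where y: "\<And>n. y n \<in> C" "\<And>n. norm (y n) > real (Suc n) * \<phi> (y n)" by metis
    have y_pos: "norm (y n) > 0" for n
      using y(2)[of n] phi_nonneg[OF y(1)[of n]]
      by (meson mult_nonneg_nonneg of_nat_0_le_iff order_le_less_trans)
    define z where "z n = inverse (norm (y n)) *\<^sub>R y n" for n
    have z_norm: "norm (z n) = 1" for n using y_pos[of n] by (simp add: z_def)
    then obtain l r where lr: "strict_mono r" "(\<lambda>n. z (r n)) \<longlonglongrightarrow> l"
      using bounded_seq_convergent_subseq[of z 1] by (metis order_refl)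
    have zC: "z n \<in> C" for n by (simp add: z_def y(1) scale_in_cone)
    have "l \<in> C"
      using Lim_in_closed_set[OF closed_C _ _ lr(2)] zC by simp
    have "norm l = 1"
      using LIMSEQ_unique[OF tendsto_norm[OF lr(2)]] z_norm by simp
    have phz: "\<phi> (z n) \<le> inverse (real (Suc n))" for n
    proof -
      have "\<phi> (z n) = \<phi> (y n) / norm (y n)" by (simp add: z_def phi_scale field_simps)
      also have "\<dots> \<le> inverse (real (Suc n))"
        using y(2)[of n] y_pos[of n] by (simp add: field_simps)
      finally show ?thesis .
    qed
    have "(\<lambda>n. \<phi> (z n)) \<longlonglongrightarrow> 0"
      by (rule tendsto_sandwich[OF _ _ tendsto_const LIMSEQ_inverse_real_of_nat])
        (use phz in \<open>auto intro!: always_eventually phi_nonneg zC simp del: of_nat_Suc\<close>)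
    from LIMSEQ_subseq_LIMSEQ[OF this lr(1)] have "(\<lambda>n. \<phi> (z (r n))) \<longlonglongrightarrow> 0" by (simp add: o_def)
    with tendsto_phi[OF lr(2)] have "\<phi> l = 0" by (rule LIMSEQ_unique)
    with phi_pos[OF \<open>l \<in> C\<close>] \<open>norm l = 1\<close> show False
      by (metis less_irrefl norm_zero zero_neq_one)
  qed
  then show thesis using that by blast
qed

end

section \<open>Order-preserving homogeneous maps of the interior\<close>

locale homogeneous_order_map = order_unit_cone +
  fixes f :: "'a \<Rightarrow> 'a"
  assumes f_into: "f \<in> interior C \<rightarrow> interior C"
    and f_mono: "order_preserving_on C (interior C) f"
    and f_hom: "homogeneous_on (interior C) f"
begin

lemma f_interior: "x \<in> interior C \<Longrightarrow> f x \<in> interior C"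
  using f_into by blast

lemma f_scale: "x \<in> interior C \<Longrightarrow> c > 0 \<Longrightarrow> f (c *\<^sub>R x) = c *\<^sub>R f x"
  using f_hom by (simp add: homogeneous_on_def)

lemma f_le: "x \<in> interior C \<Longrightarrow> x \<preceq> y \<Longrightarrow> f x \<preceq> f y"
  using f_mono interior_upward[of x y] by (simp add: order_preserving_on_def)

lemma iter_interior: "x \<in> interior C \<Longrightarrow> (f ^^ k) x \<in> interior C"
  by (induction k) (auto intro: f_interior)

lemma iter_scale: "x \<in> interior C \<Longrightarrow> c > 0 \<Longrightarrow> (f ^^ k) (c *\<^sub>R x) = c *\<^sub>R (f ^^ k) x"
  by (induction k) (auto simp: f_scale iter_interior)

lemma iter_le: "x \<in> interior C \<Longrightarrow> x \<preceq> y \<Longrightarrow> (f ^^ k) x \<preceq> (f ^^ k) y"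
  by (induction k) (auto intro: f_le iter_interior)

lemma iter_le_scale:
  "x \<in> interior C \<Longrightarrow> y \<in> interior C \<Longrightarrow> c > 0 \<Longrightarrow> x \<preceq> c *\<^sub>R y \<Longrightarrow> (f ^^ k) x \<preceq> c *\<^sub>R (f ^^ k) y"
  using iter_le[of x "c *\<^sub>R y" k] by (simp add: iter_scale)

text \<open>The step \<open>m\<close> is kept general: it is \<open>1\<close> for growth bounds, and larger where a later
  iterate lies below a multiple of the starting point.\<close>

lemma iter_of_subeigenvector:
  assumes "x \<in> interior C" "l > 0" "(f ^^ m) x \<preceq> l *\<^sub>R x"
  shows "(f ^^ (k * m)) x \<preceq> (l ^ k) *\<^sub>R x"
proof (induction k)
  case (Suc k)
  have "(f ^^ (Suc k * m)) x = (f ^^ m) ((f ^^ (k * m)) x)"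
    by (simp add: funpow_add)
  also have "\<dots> \<preceq> (l ^ k) *\<^sub>R (f ^^ m) x"
    using Suc assms by (intro iter_le_scale iter_interior) auto
  also have "(l ^ k) *\<^sub>R (f ^^ m) x \<preceq> (l ^ k) *\<^sub>R (l *\<^sub>R x)"
    using assms by (intro le_scale) auto
  finally show ?case by (simp add: mult.commute)
qed (simp add: le_refl)

text \<open>Continuity needs no hypothesis: a point near \<open>x\<close> lies between \<open>(1 - s) x\<close> and
  \<open>(1 + s) x\<close>, so its image lies between \<open>(1 - s) f x\<close> and \<open>(1 + s) f x\<close>.\<close>

lemma f_tendsto:
  assumes x: "x \<in> interior C" and X: "X \<longlonglongrightarrow> x"
  shows "(\<lambda>n. f (X n)) \<longlonglongrightarrow> f x"
proof (rule tendstoI)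
  fix e :: real assume "e > 0"
  obtain c where c: "c > 0" "\<And>y. y \<in> C \<Longrightarrow> norm y \<le> c * \<phi> y" using phi_coercive by blast
  obtain K where K: "K > 0" "\<And>y. y \<preceq> (K * norm y) *\<^sub>R x" using interior_dominates[OF x] by blast
  define M where "M = 2 * c * \<phi> (f x) + norm (f x) + 1"
  have "\<phi> (f x) > 0" using phi_interior f_interior x by blast
  then have "M > 0" using c(1) by (auto simp: M_def intro!: add_nonneg_pos)
  define s where "s = min (1/2) (e / (2 * M))"
  have s: "0 < s" "s < 1" and "s \<le> e / (2 * M)" using \<open>e > 0\<close> \<open>M > 0\<close> by (auto simp: s_def)
  then have sM: "s * M < e" using \<open>e > 0\<close> \<open>M > 0\<close> by (simp add: field_simps)
  have "\<forall>\<^sub>F n in sequentially. dist (X n) x < s / K"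
    using tendstoD[OF X] s K(1) by simp
  then show "\<forall>\<^sub>F n in sequentially. dist (f (X n)) (f x) < e"
  proof eventually_elim
    case (elim n)
    have small: "y \<preceq> s *\<^sub>R x" if "norm y = dist (X n) x" for y
      using that elim K(1) le_trans[OF K(2)[of y] le_scale_left[of x "K * norm y" s]] x interior_in_cone
      by (simp add: field_simps)
    have "x - X n \<preceq> s *\<^sub>R x" "X n - x \<preceq> s *\<^sub>R x"
      by (auto intro!: small simp: dist_norm norm_minus_commute)
    then have low: "(1 - s) *\<^sub>R x \<preceq> X n" and up: "X n \<preceq> (1 + s) *\<^sub>R x"
      by (simp_all add: cone_le_def algebra_simps)
    have "(1 - s) *\<^sub>R x \<in> interior C" using x s by (intro interior_scale) auto
    from f_le[OF this low] have low': "(1 - s) *\<^sub>R f x \<preceq> f (X n)"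
      using x s by (simp add: f_scale)
    have "X n \<in> interior C" using \<open>(1 - s) *\<^sub>R x \<in> interior C\<close> low interior_upward by blast
    from f_le[OF this up] have up': "f (X n) \<preceq> (1 + s) *\<^sub>R f x"
      using x s by (simp add: f_scale)
    have "norm (f (X n) - (1 - s) *\<^sub>R f x) \<le> c * \<phi> (f (X n) - (1 - s) *\<^sub>R f x)"
      using low' by (intro c) (simp add: cone_le_def)
    also have "\<dots> \<le> c * (2 * s * \<phi> (f x))"
      using phi_mono[OF up'] c(1) by (intro mult_left_mono)
        (auto simp: phi_scale phi_diff distrib_right left_diff_distrib)
    finally have "norm (f (X n) - (1 - s) *\<^sub>R f x) + norm (s *\<^sub>R f x) \<le> s * (M - 1)"
      using s by (simp add: M_def algebra_simps)
    moreover have "norm (f (X n) - f x) \<le> norm (f (X n) - (1 - s) *\<^sub>R f x) + norm (s *\<^sub>R f x)"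
      using norm_triangle_ineq4[of "f (X n) - (1 - s) *\<^sub>R f x" "s *\<^sub>R f x"]
      by (simp add: algebra_simps)
    ultimately show ?case using sM s by (simp add: dist_norm algebra_simps)
  qed
qed

text \<open>The limit \<open>w'\<close> may lie on the boundary of \<open>C\<close>, where \<open>f\<close> need not be defined.  The
  conclusion is what monotonicity would give if \<open>w'\<close> were interior with \<open>l w' \<preceq> f w'\<close>.\<close>

lemma limit_of_approximate_supereigenvectors:
  assumes w: "\<And>n. w n \<in> interior C" "w \<longlonglongrightarrow> w'" and e: "e \<longlonglongrightarrow> 0"
    and f_w: "\<And>n. l *\<^sub>R w n - e n \<preceq> f (w n)"
    and x: "x \<in> interior C" and c: "c > 0" "c *\<^sub>R w' \<preceq> x"
  shows "(c * l) *\<^sub>R w' \<preceq> f x"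
proof -
  obtain K where K: "K > 0" "\<And>y. y \<preceq> (K * norm y) *\<^sub>R x" using interior_dominates[OF x] by blast
  \<comment> \<open>\<open>(1 + s) x\<close> dominates \<open>c w n\<close> for large \<open>n\<close>, as \<open>s x\<close> absorbs the difference to \<open>c w'\<close>.\<close>
  have approx: "(c * l) *\<^sub>R w' \<preceq> (1 + s) *\<^sub>R f x" if "s > 0" for s
  proof (rule le_limit)
    show "(\<lambda>n. c *\<^sub>R (l *\<^sub>R w n - e n)) \<longlonglongrightarrow> (c * l) *\<^sub>R w'"
      using tendsto_scaleR[OF tendsto_const[of c] tendsto_diff[OF tendsto_scaleR[OF tendsto_const[of l] w(2)] e]]
      by simp
    have "\<forall>\<^sub>F n in sequentially. dist (w n) w' < s / (K * c)"
      using tendstoD[OF w(2)] that K(1) c(1) by simp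
    then show "\<forall>\<^sub>F n in sequentially. c *\<^sub>R (l *\<^sub>R w n - e n) \<preceq> (1 + s) *\<^sub>R f x"
    proof eventually_elim
      case (elim n)
      have "c *\<^sub>R (w n - w') \<preceq> s *\<^sub>R x"
      proof (intro le_trans[OF K(2) le_scale_left])
        show "K * norm (c *\<^sub>R (w n - w')) \<le> s"
          using elim K(1) c(1) by (simp add: dist_norm pos_less_divide_eq mult_ac del: scaleR_right_diff_distrib)
      qed (use x interior_in_cone in blast)
      from le_add[OF this c(2)] have "c *\<^sub>R w n \<preceq> (1 + s) *\<^sub>R x"
        by (simp add: algebra_simps)
      from f_le[OF interior_scale[OF w(1) c(1)] this] have "c *\<^sub>R f (w n) \<preceq> (1 + s) *\<^sub>R f x"
        using x w(1) c(1) that by (simp add: f_scale)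
      with le_scale[OF f_w[of n], of c] c(1) show ?case by (meson le_trans less_imp_le)
    qed
  qed (rule tendsto_const)
  show ?thesis
  proof (rule le_limit[OF tendsto_const])
    show "\<forall>\<^sub>F n in sequentially. (c * l) *\<^sub>R w' \<preceq> (1 + inverse (real (Suc n))) *\<^sub>R f x"
      by (intro always_eventually allI approx) simp
    show "(\<lambda>n. (1 + inverse (real (Suc n))) *\<^sub>R f x) \<longlonglongrightarrow> f x"
      using tendsto_scaleR[OF tendsto_add[OF tendsto_const[of 1] LIMSEQ_inverse_real_of_nat] tendsto_const[of "f x"]]
      by simp
  qed
qed

text \<open>The alternative on which everything rests.  It turns on whether the increasing iterates of
  \<open>x \<mapsto> f x / l + u\<close> from \<open>u\<close> stay bounded.  If they do not, then \<open>x\<^sub>n \<preceq> x\<^sub>n\<^sub>+\<^sub>1\<close> says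
  that \<open>l x\<^sub>n - l u \<preceq> f x\<^sub>n\<close>, and after normalisation the term \<open>l u\<close> vanishes in the limit.\<close>

lemma resolvent_or_growth:
  assumes l: "l > 0"
  shows "(\<exists>x\<in>interior C. (1 / l) *\<^sub>R f x + u = x) \<or> (\<exists>c>0. \<forall>k. c * l ^ k \<le> \<phi> ((f ^^ k) u))"
proof -
  define T where "T x = (1 / l) *\<^sub>R f x + u" for x
  define x where "x n = (T ^^ n) u" for n
  have T_int: "T y \<in> interior C" if "y \<in> interior C" for y
    unfolding T_def using that l f_interior interior_in_cone interior_scale interior_add
    by (simp add: interior_add u_interior)
  have T_le: "T y \<preceq> T z" if "y \<in> interior C" "y \<preceq> z" for y z
    unfolding T_def using that l by (intro le_add le_scale f_le le_refl) auto
  have x_int: "x n \<in> interior C" for n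
    unfolding x_def by (induction n) (auto intro: T_int u_interior)
  have x_step: "x n \<preceq> x (Suc n)" for n
  proof (induction n)
    case 0
    show ?case using f_interior[OF u_interior] l interior_in_cone
      by (simp add: x_def T_def cone_le_def scale_in_cone)
  next
    case (Suc n)
    from T_le[OF x_int Suc] show ?case by (simp add: x_def)
  qed
  have x_mono: "x m \<preceq> x n" if "m \<le> n" for m n
    using that by (induction rule: dec_induct) (auto intro: le_refl le_trans x_step)
  obtain b where b: "b > 0" "\<And>y. y \<in> C \<Longrightarrow> norm y \<le> b * \<phi> y" using phi_coercive by blast
  show ?thesis
  proof (cases "\<exists>R. \<forall>n. \<phi> (x n) \<le> R")
    case True
    then obtain R where "\<And>n. \<phi> (x n) \<le> R" by blast
    then have "norm (x n) \<le> b * R" for n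
      using b(2)[OF interior_in_cone[OF x_int[of n]]] b(1) by (meson mult_left_mono less_imp_le order_trans)
    then obtain r y where r: "strict_mono r" and lim: "(\<lambda>n. x (r n)) \<longlonglongrightarrow> y"
      using bounded_seq_convergent_subseq[of x "b * R"] by metis
    have x_le: "x m \<preceq> y" for m
    proof (rule le_limit[OF tendsto_const lim])
      show "\<forall>\<^sub>F n in sequentially. x m \<preceq> x (r n)"
        using eventually_ge_at_top[of m]
        by eventually_elim (meson x_mono seq_suble[OF r] order_trans)
    qed
    have y: "y \<in> interior C" using interior_upward[OF x_int x_le] .
    have lim': "(\<lambda>n. x (Suc (r n))) \<longlonglongrightarrow> T y"
      using tendsto_add[OF tendsto_scaleR[OF tendsto_const[of "1/l"] f_tendsto[OF y lim]] tendsto_const[of u]]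
      by (simp add: x_def T_def)
    have "y \<preceq> T y" by (rule le_limit[OF lim lim']) (simp add: x_step)
    moreover have "T y \<preceq> y" by (rule le_limit[OF lim' tendsto_const]) (simp add: x_le)
    ultimately have "T y = y" by (metis le_antisym)
    with y show ?thesis by (auto simp: T_def)
  next
    case False
    have ph: "\<phi> (x n) > 0" for n using x_int phi_interior by blast
    have "filterlim (\<lambda>n. \<phi> (x n)) at_top sequentially"
    proof (subst filterlim_at_top, intro allI)
      fix R
      obtain m where "\<phi> (x m) > R" using False by (meson not_le)
      then have "R \<le> \<phi> (x n)" if "m \<le> n" for n
        using phi_mono[OF x_mono[OF that]] by simp
      then show "\<forall>\<^sub>F n in sequentially. R \<le> \<phi> (x n)"
        using eventually_ge_at_top[of m] by (rule eventually_mono[rotated])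
    qed
    then have inv0: "(\<lambda>n. inverse (\<phi> (x n))) \<longlonglongrightarrow> 0"
      by (rule tendsto_inverse_0_at_top)
    define w where "w n = inverse (\<phi> (x n)) *\<^sub>R x n" for n
    have w_int: "w n \<in> interior C" for n
      unfolding w_def using ph by (intro interior_scale x_int) auto
    have ph_w: "\<phi> (w n) = 1" for n using ph[of n] by (simp add: w_def phi_scale)
    have "norm (w n) \<le> b" for n
      using b(2)[OF interior_in_cone[OF w_int[of n]]] by (simp add: ph_w)
    then obtain r w' where r: "strict_mono r" and lim: "(\<lambda>n. w (r n)) \<longlonglongrightarrow> w'"
      using bounded_seq_convergent_subseq[of w b] by metis
    have "\<phi> w' = 1" using LIMSEQ_unique[OF tendsto_phi[OF lim]] by (simp add: ph_w)
    define e where "e n = (l * inverse (\<phi> (x (r n)))) *\<^sub>R u" for n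
    have e: "e \<longlonglongrightarrow> 0"
      unfolding e_def
      using tendsto_scaleR[OF tendsto_mult[OF tendsto_const[of l] LIMSEQ_subseq_LIMSEQ[OF inv0 r]] tendsto_const[of u]]
      by (simp add: o_def)
    have f_w: "l *\<^sub>R w (r n) - e n \<preceq> f (w (r n))" for n
    proof -
      let ?x = "x (r n)" and ?p = "inverse (\<phi> (x (r n)))"
      have "f ?x = l *\<^sub>R (x (Suc (r n)) - u)" using l by (simp add: x_def T_def)
      moreover have "l *\<^sub>R (?x - u) \<preceq> l *\<^sub>R (x (Suc (r n)) - u)"
        using le_scale[OF x_step[of "r n"], of l] l by (simp add: cone_le_def algebra_simps)
      ultimately have "?p *\<^sub>R (l *\<^sub>R (?x - u)) \<preceq> ?p *\<^sub>R f ?x"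
        using ph[of "r n"] by (intro le_scale) auto
      then show ?thesis using ph[of "r n"]
        by (simp add: w_def e_def f_scale x_int algebra_simps)
    qed
    obtain c where c: "c > 0" "c *\<^sub>R w' \<preceq> u" using interior_dominates_multiple[OF u_interior] by blast
    have "(c * l ^ k) *\<^sub>R w' \<preceq> (f ^^ k) u" for k
    proof (induction k)
      case (Suc k)
      have "(c * l ^ k * l) *\<^sub>R w' \<preceq> f ((f ^^ k) u)"
        by (rule limit_of_approximate_supereigenvectors[OF _ lim e f_w _ _ Suc])
          (use c l in \<open>auto intro: iter_interior u_interior w_int\<close>)
      then show ?case by (simp add: mult_ac)
    qed (use c in simp)
    from phi_mono[OF this] have "\<forall>k. c * l ^ k \<le> \<phi> ((f ^^ k) u)"
      by (simp add: phi_scale \<open>\<phi> w' = 1\<close>)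
    with c(1) show ?thesis by blast
  qed
qed

text \<open>The Collatz--Wielandt numbers of \<open>f\<close>: the factors \<open>l\<close> for which \<open>f\<close> maps some interior
  point below its \<open>l\<close>-fold.\<close>

definition subeigenvalues :: "real set" where
  "subeigenvalues = {l. l > 0 \<and> (\<exists>x\<in>interior C. f x \<preceq> l *\<^sub>R x)}"

lemma subeigenvalues_upward: "l \<in> subeigenvalues \<Longrightarrow> l \<le> l' \<Longrightarrow> l' \<in> subeigenvalues"
proof -
  assume "l \<in> subeigenvalues" "l \<le> l'"
  then obtain x where x: "l > 0" "x \<in> interior C" "f x \<preceq> l *\<^sub>R x"
    by (auto simp: subeigenvalues_def)
  have "f x \<preceq> l' *\<^sub>R x"
    using x(3) le_scale_left[OF interior_in_cone[OF x(2)] \<open>l \<le> l'\<close>] by (rule le_trans)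
  then show ?thesis using x \<open>l \<le> l'\<close> by (auto simp: subeigenvalues_def)
qed

lemma subeigenvalues_nonempty: "subeigenvalues \<noteq> {}"
proof -
  obtain K where K: "K > 0" "\<And>y. y \<preceq> (K * norm y) *\<^sub>R u"
    using interior_dominates[OF u_interior] by blast
  have "f u \<noteq> 0" using f_interior[OF u_interior] zero_notin_interior by metis
  with K u_interior have "K * norm (f u) \<in> subeigenvalues"
    by (auto simp: subeigenvalues_def)
  then show ?thesis by blast
qed

lemma bdd_below_subeigenvalues: "bdd_below subeigenvalues"
  by (rule bdd_belowI[of _ 0]) (simp add: subeigenvalues_def)

lemma growth_upper:
  assumes "l \<in> subeigenvalues"
  obtains K where "K > 0"
    "\<And>k x. x \<in> interior C \<Longrightarrow> norm x \<le> 1 \<Longrightarrow> norm ((f ^^ k) x) \<le> K * l ^ k"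
proof -
  obtain v where v: "l > 0" "v \<in> interior C" "f v \<preceq> l *\<^sub>R v"
    using assms by (auto simp: subeigenvalues_def)
  obtain K where K: "K > 0" "\<And>y. y \<preceq> (K * norm y) *\<^sub>R v"
    using interior_dominates[OF v(2)] by blast
  obtain b where b: "b > 0" "\<And>y. y \<in> C \<Longrightarrow> norm y \<le> b * \<phi> y" using phi_coercive by blast
  have "norm ((f ^^ k) x) \<le> (b * K * \<phi> v) * l ^ k" if x: "x \<in> interior C" "norm x \<le> 1" for k x
  proof -
    have "x \<preceq> K *\<^sub>R v"
      using K x(2) v(2) interior_in_cone by (intro le_trans[OF K(2) le_scale_left]) auto
    from iter_le_scale[OF x(1) v(2) K(1) this] have "(f ^^ k) x \<preceq> K *\<^sub>R (f ^^ k) v" .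
    also have "K *\<^sub>R (f ^^ k) v \<preceq> K *\<^sub>R ((l ^ k) *\<^sub>R v)"
      using iter_of_subeigenvector[of v l 1 k] v K(1) by (intro le_scale) auto
    finally have "\<phi> ((f ^^ k) x) \<le> K * l ^ k * \<phi> v"
      by (auto dest: phi_mono simp: phi_scale mult.assoc)
    with b(1) have "b * \<phi> ((f ^^ k) x) \<le> b * (K * l ^ k * \<phi> v)" by simp
    with b(2)[OF interior_in_cone[OF iter_interior[OF x(1), of k]]] show ?thesis
      by (simp add: mult_ac)
  qed
  with b K phi_interior[OF v(2)] show thesis by (intro that[of "b * K * \<phi> v"]) auto
qed

text \<open>For these \<open>l\<close> the first case of the alternative is excluded, since a resolvent solution
  \<open>x\<close> satisfies \<open>f x \<preceq> l x\<close>.\<close>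

lemma growth_lower:
  assumes "l > 0" "l \<notin> subeigenvalues"
  obtains c where "c > 0" "\<And>k. c * l ^ k \<le> \<phi> ((f ^^ k) u)"
proof -
  have "\<not> (\<exists>x\<in>interior C. (1 / l) *\<^sub>R f x + u = x)"
  proof
    assume "\<exists>x\<in>interior C. (1 / l) *\<^sub>R f x + u = x"
    then obtain x where x: "x \<in> interior C" "(1 / l) *\<^sub>R f x + u = x" by blast
    have "l *\<^sub>R x = f x + l *\<^sub>R u"
      using assms(1) by (subst x(2)[symmetric]) (simp add: algebra_simps)
    then have "f x \<preceq> l *\<^sub>R x"
      using assms(1) u_interior by (simp add: cone_le_def scale_in_cone interior_in_cone)
    with x assms show False by (auto simp: subeigenvalues_def)
  qed
  with resolvent_or_growth[OF assms(1)] that show thesis by blast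
qed

lemma interior_norm_le:
  assumes "\<And>x. x \<in> interior C \<Longrightarrow> norm x \<le> 1 \<Longrightarrow> norm (h x) \<le> B"
  shows "interior_norm C h \<le> B"
proof -
  have "u \<noteq> 0" using u_interior zero_notin_interior by metis
  then have "inverse (norm u) *\<^sub>R u \<in> interior C" "norm (inverse (norm u) *\<^sub>R u) \<le> 1"
    by (auto intro!: interior_scale u_interior)
  then have "{norm (h x) | x. x \<in> interior C \<and> norm x \<le> 1} \<noteq> {}" by blast
  then show ?thesis
    unfolding interior_norm_def by (rule cSup_least) (use assms in auto)
qed

text \<open>The upper growth bound makes the supremum range over a bounded set.\<close>

lemma interior_norm_ge:
  assumes "x \<in> interior C" "norm x \<le> 1"
  shows "norm ((f ^^ k) x) \<le> interior_norm C (f ^^ k)"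
proof -
  obtain l where l: "l \<in> subeigenvalues" using subeigenvalues_nonempty by blast
  obtain K where "\<And>x. x \<in> interior C \<Longrightarrow> norm x \<le> 1 \<Longrightarrow> norm ((f ^^ k) x) \<le> K * l ^ k"
    using growth_upper[OF l] by metis
  then have "bdd_above {norm ((f ^^ k) x) | x. x \<in> interior C \<and> norm x \<le> 1}"
    by (intro bdd_aboveI[of _ "K * l ^ k"]) auto
  moreover have "norm ((f ^^ k) x) \<in> {norm ((f ^^ k) x) | x. x \<in> interior C \<and> norm x \<le> 1}"
    using assms by blast
  ultimately show ?thesis
    unfolding interior_norm_def by (rule cSup_upper[rotated])
qed

text \<open>The two growth bounds also show that the sequence of roots converges, which is needed because
  the partial spectral radius is defined by the total operator \<^const>\<open>lim\<close>.\<close>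

lemma partial_spectral_radius_eq: "partial_spectral_radius C f = Inf subeigenvalues"
proof -
  define N where "N k = interior_norm C (f ^^ k)" for k
  define u1 where "u1 = inverse (norm u) *\<^sub>R u"
  have u_pos: "norm u > 0" using u_interior zero_notin_interior by (metis zero_less_norm_iff)
  then have u1: "u1 \<in> interior C" "norm u1 \<le> 1"
    by (auto simp: u1_def intro!: interior_scale u_interior)
  have N_ge: "norm ((f ^^ k) u1) \<le> N k" for k unfolding N_def by (rule interior_norm_ge[OF u1])
  then have N_nonneg: "0 \<le> N k" for k by (meson norm_ge_zero order_trans)
  have Inf_le: "Inf subeigenvalues \<le> l" if "l \<in> subeigenvalues" for l
    using that bdd_below_subeigenvalues by (rule cInf_lower)
  have root_lim: "(\<lambda>k. root k K * l) \<longlonglongrightarrow> l" if "K > 0" for K l :: real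
    using tendsto_mult[OF LIMSEQ_root_const[OF that] tendsto_const[of l]] by simp
  have "(\<lambda>k. root k (N k)) \<longlonglongrightarrow> Inf subeigenvalues"
  proof (rule order_tendstoI)
    fix a assume a: "a < Inf subeigenvalues"
    show "\<forall>\<^sub>F k in sequentially. a < root k (N k)"
    proof (cases "a < 0")
      case True
      then show ?thesis
        using N_nonneg by (intro always_eventually allI order_less_le_trans[OF True]) (simp add: real_root_ge_zero)
    next
      case False
      obtain l where l: "a < l" "l < Inf subeigenvalues" using a dense by blast
      with False have "l > 0" by simp
      have "l \<notin> subeigenvalues" using Inf_le l(2) by force
      with \<open>l > 0\<close> obtain c where c: "c > 0" "\<And>k. c * l ^ k \<le> \<phi> ((f ^^ k) u)"
        using growth_lower by blast
      obtain K where K: "K > 0" "\<And>y. \<phi> y \<le> K * norm y" using phi_bounded by blast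
      define c' where "c' = c / (K * norm u)"
      have c': "c' > 0" using c(1) K(1) u_pos by (simp add: c'_def)
      have low: "c' * l ^ k \<le> N k" for k
      proof -
        have "(f ^^ k) u1 = inverse (norm u) *\<^sub>R (f ^^ k) u"
          unfolding u1_def using u_pos by (intro iter_scale u_interior) auto
        then have "norm ((f ^^ k) u) = norm u * norm ((f ^^ k) u1)" using u_pos by simp
        with c(2)[of k] K(2)[of "(f ^^ k) u"] have "c * l ^ k \<le> K * (norm u * norm ((f ^^ k) u1))"
          by simp
        also have "\<dots> \<le> K * (norm u * N k)"
          using K(1) u_pos N_ge by (intro mult_left_mono) auto
        finally show ?thesis using K(1) u_pos by (simp add: c'_def field_simps)
      qed
      have "\<forall>\<^sub>F k in sequentially. a < root k c' * l"
        using order_tendstoD(1)[OF root_lim[OF c'] l(1)] .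
      then show ?thesis using eventually_gt_at_top[of 0]
      proof eventually_elim
        case (elim k)
        have "root k c' * l = root k (c' * l ^ k)"
          using elim(2) \<open>l > 0\<close> by (simp add: real_root_mult real_root_power_cancel)
        also have "\<dots> \<le> root k (N k)" using elim(2) low by simp
        finally show ?case using elim(1) by simp
      qed
    qed
  next
    fix a assume "Inf subeigenvalues < a"
    then obtain l where l: "l \<in> subeigenvalues" "l < a"
      using cInf_lessD[OF subeigenvalues_nonempty] by blast
    then have "l > 0" by (simp add: subeigenvalues_def)
    obtain K where K: "K > 0"
      "\<And>k x. x \<in> interior C \<Longrightarrow> norm x \<le> 1 \<Longrightarrow> norm ((f ^^ k) x) \<le> K * l ^ k"
      using growth_upper[OF l(1)] by blast
    then have up: "N k \<le> K * l ^ k" for k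
      unfolding N_def by (intro interior_norm_le)
    have "\<forall>\<^sub>F k in sequentially. root k K * l < a"
      using order_tendstoD(2)[OF root_lim[OF K(1)] l(2)] .
    then show "\<forall>\<^sub>F k in sequentially. root k (N k) < a" using eventually_gt_at_top[of 0]
    proof eventually_elim
      case (elim k)
      have "root k (N k) \<le> root k (K * l ^ k)" using elim(2) up by simp
      also have "\<dots> = root k K * l"
        using elim(2) \<open>l > 0\<close> by (simp add: real_root_mult real_root_power_cancel)
      finally show ?case using elim(1) by simp
    qed
  qed
  then show ?thesis unfolding partial_spectral_radius_def N_def by (rule limI)
qed

end

section \<open>Maps of partial spectral radius one\<close>

locale spectral_radius_one = homogeneous_order_map +
  assumes radius: "partial_spectral_radius C f = 1"
begin

lemma subeigenvalues_iff: "l \<noteq> 1 \<Longrightarrow> l \<in> subeigenvalues \<longleftrightarrow> l > 1"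
proof -
  assume "l \<noteq> 1"
  have Inf1: "Inf subeigenvalues = 1" using radius by (simp add: partial_spectral_radius_eq)
  show ?thesis
  proof
    assume "l \<in> subeigenvalues"
    then have "Inf subeigenvalues \<le> l" using bdd_below_subeigenvalues by (rule cInf_lower)
    with Inf1 \<open>l \<noteq> 1\<close> show "l > 1" by simp
  next
    assume "l > 1"
    then obtain l' where "l' \<in> subeigenvalues" "l' < l"
      using cInf_lessD[OF subeigenvalues_nonempty, of l] Inf1 by metis
    then show "l \<in> subeigenvalues" using subeigenvalues_upward[of l' l] by simp
  qed
qed

lemma resolvent:
  assumes "l > 1"
  shows "\<exists>x\<in>interior C. (1 / l) *\<^sub>R f x + u = x"
proof (rule ccontr)
  assume "\<not> ?thesis"
  with resolvent_or_growth[of l] assms obtain c where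
    c: "c > 0" "\<And>k. c * l ^ k \<le> \<phi> ((f ^^ k) u)" by auto
  define m where "m = (1 + l) / 2"
  have m: "1 < m" "m < l" using assms by (auto simp: m_def)
  then have "m \<in> subeigenvalues" using subeigenvalues_iff[of m] by simp
  then obtain v where v: "v \<in> interior C" "f v \<preceq> m *\<^sub>R v" by (auto simp: subeigenvalues_def)
  obtain K where K: "K > 0" "\<And>y. y \<preceq> (K * norm y) *\<^sub>R v"
    using interior_dominates[OF v(1)] by blast
  have "K * norm u > 0" using K(1) u_interior zero_notin_interior by (metis zero_less_mult_iff zero_less_norm_iff)
  have "c * l ^ k \<le> (K * norm u * \<phi> v) * m ^ k" for k
  proof -
    have "(f ^^ k) u \<preceq> (K * norm u) *\<^sub>R (f ^^ k) v"
      by (rule iter_le_scale[OF u_interior v(1) \<open>K * norm u > 0\<close> K(2)])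
    also have "(K * norm u) *\<^sub>R (f ^^ k) v \<preceq> (K * norm u) *\<^sub>R ((m ^ k) *\<^sub>R v)"
      using iter_of_subeigenvector[of v m 1 k] v m \<open>K * norm u > 0\<close> by (intro le_scale) auto
    finally have "\<phi> ((f ^^ k) u) \<le> K * norm u * m ^ k * \<phi> v"
      by (auto dest: phi_mono simp: phi_scale mult.assoc)
    with c(2)[of k] show ?thesis by (simp add: mult_ac)
  qed
  with no_power_domination[of c m l "K * norm u * \<phi> v"] c(1) m show False
    by (metis not_le less_trans zero_less_one)
qed

text \<open>If \<open>\<phi> (f\<^sup>k x)\<close> were very small for some \<open>k\<close>, then \<open>f\<^sup>k x \<preceq> x / 2\<close>, and all orbits would
  decay at least like \<open>2\<^sup>-\<^sup>j\<^sup>/\<^sup>k\<close> in the number \<open>j\<close> of steps.  This contradicts the lower growth bound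
  for \<open>l = (3/4)\<^sup>1\<^sup>/\<^sup>k < 1\<close>.\<close>

lemma orbit_bounded_below:
  assumes x: "x \<in> interior C"
  obtains \<eta> where "\<eta> > 0" "\<And>k. \<eta> \<le> \<phi> ((f ^^ k) x)"
proof -
  obtain K where K: "K > 0" "\<And>y. y \<preceq> (K * norm y) *\<^sub>R x" using interior_dominates[OF x] by blast
  obtain b where b: "b > 0" "\<And>y. y \<in> C \<Longrightarrow> norm y \<le> b * \<phi> y" using phi_coercive by blast
  define \<eta> where "\<eta> = 1 / (2 * K * b)"
  have "\<eta> \<le> \<phi> ((f ^^ k) x)" for k
  proof (rule ccontr)
    assume "\<not> ?thesis"
    then have less: "b * \<phi> ((f ^^ k) x) < 1 / (2 * K)"
      using K(1) b(1) by (simp add: \<eta>_def field_simps)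
    have "norm ((f ^^ k) x) \<le> 1 / (2 * K)"
      using b(2)[OF interior_in_cone[OF iter_interior[OF x, of k]]] less by linarith
    then have half: "(f ^^ k) x \<preceq> (1/2) *\<^sub>R x"
      using K(1) x interior_in_cone by (intro le_trans[OF K(2) le_scale_left]) (auto simp: field_simps)
    have "k > 0"
    proof (rule ccontr)
      assume "\<not> k > 0"
      with phi_mono[OF half] phi_interior[OF x] show False by (simp add: phi_scale)
    qed
    define l where "l = root k (3/4)"
    have l: "0 < l" "l < 1" "l ^ k = 3/4"
      using \<open>k > 0\<close> by (auto simp: l_def real_root_gt_zero real_root_pow_pos2)
    then have "l \<notin> subeigenvalues" using subeigenvalues_iff[of l] by simp
    with l(1) obtain c where c: "c > 0" "\<And>j. c * l ^ j \<le> \<phi> ((f ^^ j) u)"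
      using growth_lower by blast
    have K': "K * norm u > 0"
      using K(1) u_interior zero_notin_interior by (metis zero_less_mult_iff zero_less_norm_iff)
    have "c * (3/4) ^ j \<le> (K * norm u * \<phi> x) * (1/2) ^ j" for j
    proof -
      have "(f ^^ (j * k)) u \<preceq> (K * norm u) *\<^sub>R (f ^^ (j * k)) x"
        by (rule iter_le_scale[OF u_interior x K' K(2)])
      also have "(K * norm u) *\<^sub>R (f ^^ (j * k)) x \<preceq> (K * norm u) *\<^sub>R ((1/2) ^ j *\<^sub>R x)"
        using iter_of_subeigenvector[OF x _ half] K' by (intro le_scale) auto
      finally have "\<phi> ((f ^^ (j * k)) u) \<le> K * norm u * (1/2) ^ j * \<phi> x"
        by (auto dest: phi_mono simp: phi_scale mult.assoc)
      moreover have "l ^ (j * k) = (3/4) ^ j"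
        using l(3) by (metis mult.commute power_mult)
      ultimately show ?thesis using c(2)[of "j * k"] by (simp add: mult_ac)
    qed
    with no_power_domination[of c "1/2" "3/4" "K * norm u * \<phi> x"] c(1) show False
      by (force simp: not_le[symmetric])
  qed
  with K b show thesis by (intro that[of \<eta>]) (auto simp: \<eta>_def)
qed

text \<open>An orbit that stays in a bounded part of the interior yields a fixed point, without
  recourse to Brouwer's theorem.  Solutions of \<open>x = (1 - t) f x + t u\<close> are compared with the orbit
  of \<open>z\<close>: a lower bound \<open>\<mu> f\<^sup>k z \<preceq> x\<close> for all \<open>k \<ge> j\<close> improves to
  \<open>((1 - t) \<mu> + t / B) f\<^sup>k z \<preceq> x\<close> for all \<open>k \<ge> j + 1\<close>, and iteration from \<open>\<mu> = 0\<close> converges to the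
  factor \<open>1 / B\<close>, whatever \<open>t\<close> is.  Upper bounds converge to the factor \<open>1 / c\<close> in the same way.\<close>

lemma fixed_point_of_bounded_orbit:
  assumes z: "z \<in> interior C" and c: "c > 0" "\<And>k. c *\<^sub>R u \<preceq> (f ^^ k) z"
    and B: "B > 0" "\<And>k. (f ^^ k) z \<preceq> B *\<^sub>R u"
  shows "\<exists>x\<in>interior C. f x = x"
proof -
  have approx: "\<exists>x. x = (1 - t) *\<^sub>R f x + t *\<^sub>R u \<and> (c / B) *\<^sub>R u \<preceq> x \<and> x \<preceq> (B / c) *\<^sub>R u"
    if t: "0 < t" "t < 1" for t
  proof -
    have "1 / (1 - t) > 1" using t by simp
    from resolvent[OF this] obtain x' where x': "x' \<in> interior C" "(1 - t) *\<^sub>R f x' + u = x'"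
      by auto
    define x where "x = t *\<^sub>R x'"
    have x: "x \<in> interior C" using t x' by (simp add: x_def interior_scale)
    have x_eq: "x = (1 - t) *\<^sub>R f x + t *\<^sub>R u"
      using arg_cong[OF x'(2), of "\<lambda>y. t *\<^sub>R y"] t x'
      by (simp add: x_def f_scale algebra_simps)
    have pow0: "(\<lambda>j. (1 - t) ^ j) \<longlonglongrightarrow> 0" using t by (intro LIMSEQ_realpow_zero) auto
    have u_le: "u \<preceq> (1 / c) *\<^sub>R (f ^^ k) z" and le_u: "(1 / B) *\<^sub>R (f ^^ k) z \<preceq> u" for k
      using le_scale[OF c(2)[of k], of "1 / c"] le_scale[OF B(2)[of k], of "1 / B"] c(1) B(1) by auto
    \<comment> \<open>\<open>\<mu>\<close> solves the recursion \<open>\<mu> (Suc j) = (1 - t) \<mu> j + t / B\<close> with \<open>\<mu> 0 = 0\<close>.\<close>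
    define \<mu> where "\<mu> j = (1 - (1 - t) ^ j) / B" for j :: nat
    have \<mu>: "\<mu> j *\<^sub>R (f ^^ k) z \<preceq> x" if "j \<le> k" for j k
      using that
    proof (induction j arbitrary: k)
      case 0
      show ?case using x by (simp add: \<mu>_def cone_le_def interior_in_cone)
    next
      case (Suc j)
      then obtain k' where k': "k = Suc k'" "j \<le> k'" by (cases k) auto
      have "\<mu> j *\<^sub>R (f ^^ k) z \<preceq> f x"
      proof (cases "\<mu> j = 0")
        case True
        then show ?thesis using f_interior[OF x] by (simp add: cone_le_def interior_in_cone)
      next
        case False
        have "\<mu> j \<ge> 0" using t B(1) by (simp add: \<mu>_def power_le_one)
        with False have "\<mu> j > 0" by simp
        with f_le[OF interior_scale[OF iter_interior[OF z]] Suc.IH[OF k'(2)]] show ?thesis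
          by (simp add: k'(1) f_scale iter_interior z)
      qed
      then have "(1 - t) *\<^sub>R (\<mu> j *\<^sub>R (f ^^ k) z) + t *\<^sub>R ((1 / B) *\<^sub>R (f ^^ k) z) \<preceq> (1 - t) *\<^sub>R f x + t *\<^sub>R u"
        using t by (intro le_add le_scale le_u) auto
      moreover have "(1 - t) * \<mu> j + t * (1 / B) = \<mu> (Suc j)"
        using B(1) by (simp add: \<mu>_def field_simps)
      ultimately show ?case by (metis x_eq scaleR_scaleR scaleR_left_distrib)
    qed
    have "(\<mu> j * c) *\<^sub>R u \<preceq> x" for j
    proof -
      have "\<mu> j *\<^sub>R (c *\<^sub>R u) \<preceq> \<mu> j *\<^sub>R (f ^^ j) z"
        using t B(1) by (intro le_scale c(2)) (simp add: \<mu>_def power_le_one)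
      with \<mu>[of j j] show ?thesis by (auto intro: le_trans)
    qed
    moreover have "(\<lambda>j. (\<mu> j * c) *\<^sub>R u) \<longlonglongrightarrow> ((1 - 0) / B * c) *\<^sub>R u"
      unfolding \<mu>_def by (intro tendsto_intros pow0) (use B(1) in auto)
    ultimately have lower: "((1 - 0) / B * c) *\<^sub>R u \<preceq> x"
      by (intro le_limit[OF _ tendsto_const]) auto
    obtain K where K: "K > 0" "\<And>y. y \<preceq> (K * norm y) *\<^sub>R u"
      using interior_dominates[OF u_interior] by blast
    \<comment> \<open>\<open>\<nu>\<close> solves \<open>\<nu> (Suc j) = (1 - t) \<nu> j + t / c\<close>, and \<open>\<nu> 0\<close> is large enough to start.\<close>
    define \<nu> where "\<nu> j = (1 + K * norm x * (1 - t) ^ j) / c" for j :: nat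
    have \<nu>_pos: "\<nu> j > 0" for j
      unfolding \<nu>_def using t K(1) c(1) by (intro divide_pos_pos add_pos_nonneg) auto
    have \<nu>: "x \<preceq> \<nu> j *\<^sub>R (f ^^ k) z" if "j \<le> k" for j k
      using that
    proof (induction j arbitrary: k)
      case 0
      have "x \<preceq> (K * norm x) *\<^sub>R ((1 / c) *\<^sub>R (f ^^ k) z)"
        using K(1) by (intro le_trans[OF K(2) le_scale[OF u_le]]) auto
      also have "\<dots> \<preceq> \<nu> 0 *\<^sub>R (f ^^ k) z"
        unfolding scaleR_scaleR using c(1) iter_interior[OF z] interior_in_cone
        by (intro le_scale_left) (auto simp: \<nu>_def field_simps)
      finally show ?case .
    next
      case (Suc j)
      then obtain k' where k': "k = Suc k'" "j \<le> k'" by (cases k) auto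
      have "f x \<preceq> \<nu> j *\<^sub>R (f ^^ k) z"
        using f_le[OF x Suc.IH[OF k'(2)]] by (simp add: k'(1) f_scale iter_interior z \<nu>_pos)
      then have "(1 - t) *\<^sub>R f x + t *\<^sub>R u \<preceq> (1 - t) *\<^sub>R (\<nu> j *\<^sub>R (f ^^ k) z) + t *\<^sub>R ((1 / c) *\<^sub>R (f ^^ k) z)"
        using t by (intro le_add le_scale u_le) auto
      moreover have "(1 - t) * \<nu> j + t * (1 / c) = \<nu> (Suc j)"
        using c(1) by (simp add: \<nu>_def field_simps)
      ultimately show ?case by (metis x_eq scaleR_scaleR scaleR_left_distrib)
    qed
    have "x \<preceq> (\<nu> j * B) *\<^sub>R u" for j
      using le_trans[OF \<nu>[of j j] le_scale[OF B(2)[of j], of "\<nu> j"]] \<nu>_pos[of j] by simp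
    moreover have "(\<lambda>j. (\<nu> j * B) *\<^sub>R u) \<longlonglongrightarrow> ((1 + K * norm x * 0) / c * B) *\<^sub>R u"
      unfolding \<nu>_def by (intro tendsto_intros pow0) (use c(1) in auto)
    ultimately have "x \<preceq> ((1 + K * norm x * 0) / c * B) *\<^sub>R u"
      by (intro le_limit[OF tendsto_const]) auto
    with lower x_eq show ?thesis by (intro exI[of _ x]) simp
  qed
  define t where "t n = inverse (real (Suc (Suc n)))" for n
  have t: "0 < t n" "t n < 1" for n by (auto simp: t_def inverse_less_1_iff simp del: of_nat_Suc)
  have t_lim: "t \<longlonglongrightarrow> 0"
    unfolding t_def using LIMSEQ_Suc[OF LIMSEQ_inverse_real_of_nat] .
  obtain x where x: "\<And>n. x n = (1 - t n) *\<^sub>R f (x n) + t n *\<^sub>R u"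
    "\<And>n. (c / B) *\<^sub>R u \<preceq> x n" "\<And>n. x n \<preceq> (B / c) *\<^sub>R u"
    using approx[OF t] by metis
  obtain b where b: "b > 0" "\<And>y. y \<in> C \<Longrightarrow> norm y \<le> b * \<phi> y" using phi_coercive by blast
  have low_int: "(c / B) *\<^sub>R u \<in> interior C" using c(1) B(1) by (simp add: interior_scale u_interior)
  have "norm (x n) \<le> b * \<phi> ((B / c) *\<^sub>R u)" for n
  proof -
    have "x n \<in> C" using interior_upward[OF low_int x(2)] interior_in_cone by blast
    then have "norm (x n) \<le> b * \<phi> (x n)" by (rule b(2))
    also have "\<dots> \<le> b * \<phi> ((B / c) *\<^sub>R u)" using phi_mono[OF x(3)] b(1) by simp
    finally show ?thesis .
  qed
  then obtain r y where r: "strict_mono r" and lim: "(\<lambda>n. x (r n)) \<longlonglongrightarrow> y"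
    using bounded_seq_convergent_subseq by metis
  have "(c / B) *\<^sub>R u \<preceq> y" by (rule le_limit[OF tendsto_const lim]) (simp add: x(2))
  then have y: "y \<in> interior C" using interior_upward low_int by blast
  have "(\<lambda>n. t (r n)) \<longlonglongrightarrow> 0" using LIMSEQ_subseq_LIMSEQ[OF t_lim r] by (simp add: o_def)
  then have "(\<lambda>n. (1 - t (r n)) *\<^sub>R f (x (r n)) + t (r n) *\<^sub>R u) \<longlonglongrightarrow> (1 - 0) *\<^sub>R f y + 0 *\<^sub>R u"
    by (intro tendsto_intros f_tendsto[OF y lim])
  then have "(\<lambda>n. x (r n)) \<longlonglongrightarrow> f y" using x(1) by simp
  with lim have "f y = y" using LIMSEQ_unique by blast
  with y show ?thesis by blast
qed

lemma normalized_map_iter: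
  assumes "x \<in> interior C" "\<phi> x = 1"
  shows "(normalized_map \<phi> f ^^ k) x = (f ^^ k) x /\<^sub>R \<phi> ((f ^^ k) x)"
proof (induction k)
  case (Suc k)
  let ?y = "(f ^^ k) x"
  have "\<phi> ?y > 0" "\<phi> (f ?y) > 0" "?y \<in> interior C"
    using assms iter_interior f_interior phi_interior by auto
  then show ?case using Suc
    by (simp add: normalized_map_def f_scale phi_scale)
qed (use assms in simp)

lemma accumulation_point_in_slice:
  assumes x: "x \<in> open_slice C \<phi>" and k: "(\<lambda>i. (normalized_map \<phi> f ^^ k i) x) \<longlonglongrightarrow> y"
  shows "y \<in> C" "\<phi> y = 1"
proof -
  have x': "x \<in> interior C" "\<phi> x = 1" using x by (auto simp: open_slice_def)
  have ph: "\<phi> ((f ^^ j) x) > 0" for j using x' iter_interior phi_interior by blast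
  have "(normalized_map \<phi> f ^^ j) x \<in> C" for j
    using ph[of j] x' by (simp add: normalized_map_iter scale_in_cone interior_in_cone iter_interior)
  then show "y \<in> C" using Lim_in_closed_set[OF closed_C _ _ k] by simp
  have "\<phi> ((normalized_map \<phi> f ^^ j) x) = 1" for j
    using ph[of j] x' by (simp add: normalized_map_iter phi_scale)
  with tendsto_phi[OF k] have "(\<lambda>i. 1) \<longlonglongrightarrow> \<phi> y" by simp
  then show "\<phi> y = 1" by (simp add: LIMSEQ_const_iff)
qed

lemma slice_boundaryI:
  "y \<in> C \<Longrightarrow> \<phi> y = 1 \<Longrightarrow> y \<notin> interior C \<Longrightarrow> y \<in> slice_boundary C \<phi>"
  using closure_subset by (auto simp: slice_boundary_def frontier_def)

section \<open>Bounded orbits\<close>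

text \<open>The points of the slice that lie below an entire orbit of \<open>f\<close>.  If the orbits of \<open>f\<close> are
  bounded and there is no fixed point, this is the required convex set.\<close>

definition minorants :: "'a set" where
  "minorants = {y \<in> C. \<phi> y = 1 \<and> (\<exists>z\<in>interior C. \<forall>k. y \<preceq> (f ^^ k) z)}"

lemma convex_minorants: "convex minorants"
proof (rule convexI)
  fix y1 y2 and a b :: real
  assume y: "y1 \<in> minorants" "y2 \<in> minorants" and ab: "0 \<le> a" "0 \<le> b" "a + b = 1"
  from y obtain z1 z2 where z: "z1 \<in> interior C" "z2 \<in> interior C"
    "\<And>k. y1 \<preceq> (f ^^ k) z1" "\<And>k. y2 \<preceq> (f ^^ k) z2"
    by (auto simp: minorants_def)
  have "a *\<^sub>R y1 + b *\<^sub>R y2 \<preceq> (f ^^ k) (z1 + z2)" for k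
  proof -
    have "(f ^^ k) z1 \<preceq> (f ^^ k) (z1 + z2)" "(f ^^ k) z2 \<preceq> (f ^^ k) (z1 + z2)"
      by (rule iter_le[OF z(1)] iter_le[OF z(2)],
          simp add: cone_le_def interior_in_cone z)+
    with z(3,4) have "y1 \<preceq> (f ^^ k) (z1 + z2)" "y2 \<preceq> (f ^^ k) (z1 + z2)"
      by (blast intro: le_trans)+
    with ab have "a *\<^sub>R y1 + b *\<^sub>R y2 \<preceq> a *\<^sub>R (f ^^ k) (z1 + z2) + b *\<^sub>R (f ^^ k) (z1 + z2)"
      by (intro le_add le_scale)
    with ab(3) show ?thesis by (metis scaleR_left_distrib scaleR_one)
  qed
  moreover have "z1 + z2 \<in> interior C" using z interior_in_cone interior_add by blast
  moreover have "a *\<^sub>R y1 + b *\<^sub>R y2 \<in> C"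
    using y ab by (intro add_in_cone scale_in_cone) (auto simp: minorants_def)
  moreover have "\<phi> (a *\<^sub>R y1 + b *\<^sub>R y2) = 1"
    using y ab by (simp add: minorants_def phi_add phi_scale)
  ultimately show "a *\<^sub>R y1 + b *\<^sub>R y2 \<in> minorants" unfolding minorants_def by blast
qed

lemma convex_attractor_if_bounded:
  assumes no_fix: "\<not> (\<exists>x\<in>interior C. f x = x)"
    and x0: "x0 \<in> interior C" "\<And>k. norm ((f ^^ k) x0) \<le> R"
  shows "minorants \<subseteq> slice_boundary C \<phi>"
    and "x \<in> open_slice C \<phi> \<Longrightarrow> orbit_accumulation_points (normalized_map \<phi> f) x \<subseteq> minorants"
proof -
  obtain K where K: "K > 0" "\<And>y. y \<preceq> (K * norm y) *\<^sub>R u"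
    using interior_dominates[OF u_interior] by blast
  have orbit_le: "\<exists>B>0. \<forall>k. (f ^^ k) z \<preceq> B *\<^sub>R u" if z: "z \<in> interior C" for z
  proof -
    obtain L where L: "L > 0" "\<And>y. y \<preceq> (L * norm y) *\<^sub>R x0" using interior_dominates[OF x0(1)] by blast
    define M where "M = L * norm z + 1"
    have M: "M > 0" using L(1) by (simp add: M_def add_nonneg_pos)
    have "z \<preceq> M *\<^sub>R x0"
      by (rule le_trans[OF L(2) le_scale_left]) (auto simp: M_def x0 interior_in_cone)
    have "(f ^^ k) z \<preceq> (M * (K * (\<bar>R\<bar> + 1))) *\<^sub>R u" for k
    proof -
      have "(f ^^ k) z \<preceq> M *\<^sub>R (f ^^ k) x0"
        by (rule iter_le_scale[OF z x0(1) M \<open>z \<preceq> M *\<^sub>R x0\<close>])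
      also have "M *\<^sub>R (f ^^ k) x0 \<preceq> M *\<^sub>R ((K * norm ((f ^^ k) x0)) *\<^sub>R u)"
        using M by (intro le_scale K(2)) simp
      also have "\<dots> \<preceq> (M * (K * (\<bar>R\<bar> + 1))) *\<^sub>R u"
        unfolding scaleR_scaleR
        using M K(1) x0(2)[of k] by (intro le_scale_left mult_left_mono interior_in_cone u_interior) auto
      finally show ?thesis .
    qed
    then show ?thesis using M K(1) by (intro exI[of _ "M * (K * (\<bar>R\<bar> + 1))"]) (auto intro!: mult_pos_pos)
  qed
  show "minorants \<subseteq> slice_boundary C \<phi>"
  proof
    fix y assume "y \<in> minorants"
    then obtain z where y: "y \<in> C" "\<phi> y = 1" and z: "z \<in> interior C" "\<And>k. y \<preceq> (f ^^ k) z"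
      by (auto simp: minorants_def)
    show "y \<in> slice_boundary C \<phi>"
    proof (rule slice_boundaryI[OF y notI])
      assume "y \<in> interior C"
      then obtain c where c: "c > 0" "c *\<^sub>R u \<preceq> y" using interior_dominates_multiple by blast
      obtain B where "B > 0" "\<And>k. (f ^^ k) z \<preceq> B *\<^sub>R u" using orbit_le[OF z(1)] by blast
      with fixed_point_of_bounded_orbit[OF z(1) c(1) le_trans[OF c(2) z(2)]] no_fix
      show False by blast
    qed
  qed
  assume x: "x \<in> open_slice C \<phi>"
  then have x': "x \<in> interior C" "\<phi> x = 1" by (auto simp: open_slice_def)
  show "orbit_accumulation_points (normalized_map \<phi> f) x \<subseteq> minorants"
  proof
    fix y assume "y \<in> orbit_accumulation_points (normalized_map \<phi> f) x"
    then obtain k :: "nat \<Rightarrow> nat" where k: "filterlim k at_top sequentially"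
      and lim: "(\<lambda>i. (normalized_map \<phi> f ^^ k i) x) \<longlonglongrightarrow> y"
      by (auto simp: orbit_accumulation_points_def)
    obtain B where B: "B > 0" "\<And>k. (f ^^ k) x \<preceq> B *\<^sub>R u" using orbit_le[OF x'(1)] by blast
    obtain \<eta> where \<eta>: "\<eta> > 0" "\<And>k. \<eta> \<le> \<phi> ((f ^^ k) x)" using orbit_bounded_below[OF x'(1)] by blast
    have "y \<preceq> (f ^^ m) ((B / \<eta>) *\<^sub>R u)" for m
    proof (rule le_limit[OF lim tendsto_const])
      have "\<forall>\<^sub>F i in sequentially. k i \<ge> m" using k by (simp add: filterlim_at_top)
      then show "\<forall>\<^sub>F i in sequentially. (normalized_map \<phi> f ^^ k i) x \<preceq> (f ^^ m) ((B / \<eta>) *\<^sub>R u)"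
      proof eventually_elim
        case (elim i)
        have "(f ^^ k i) x = (f ^^ m) ((f ^^ (k i - m)) x)"
          using elim by (metis add_diff_inverse_nat comp_apply funpow_add not_le)
        also have "\<dots> \<preceq> B *\<^sub>R (f ^^ m) u"
          by (intro iter_le_scale iter_interior x' u_interior B)
        finally have "(f ^^ k i) x /\<^sub>R \<phi> ((f ^^ k i) x) \<preceq> (B *\<^sub>R (f ^^ m) u) /\<^sub>R \<phi> ((f ^^ k i) x)"
          using \<eta>(1) \<eta>(2)[of "k i"] by (intro le_scale) auto
        also have "\<dots> \<preceq> (B / \<eta>) *\<^sub>R (f ^^ m) u"
          unfolding scaleR_scaleR using \<eta>(1) \<eta>(2)[of "k i"] B(1)
          by (intro le_scale_left interior_in_cone iter_interior u_interior)
            (simp add: field_simps mult_left_mono)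
        finally show ?case
          using x' B(1) \<eta>(1) by (simp add: normalized_map_iter iter_scale u_interior)
      qed
    qed
    moreover have "(B / \<eta>) *\<^sub>R u \<in> interior C" using B(1) \<eta>(1) by (simp add: interior_scale u_interior)
    ultimately show "y \<in> minorants"
      using accumulation_point_in_slice[OF x lim] unfolding minorants_def by blast
  qed
qed

section \<open>Unbounded orbits\<close>

text \<open>The least \<open>\<beta>\<close> with \<open>u \<preceq> \<beta> v\<close> is needed only up to a factor of two.\<close>

lemma near_optimal_dilation:
  assumes v: "v \<in> interior C"
  shows "\<exists>\<beta>>0. u \<preceq> \<beta> *\<^sub>R v \<and> \<not> u \<preceq> (\<beta> / 2) *\<^sub>R v"
proof -
  obtain a where a: "a > 0" "a *\<^sub>R u \<preceq> v" using interior_dominates_multiple[OF v] by blast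
  define b where "b = 1 / a"
  have b: "b > 0" "u \<preceq> b *\<^sub>R v" using a le_scale[OF a(2), of b] by (auto simp: b_def)
  have "\<exists>j. \<not> u \<preceq> (b * (1/2) ^ j) *\<^sub>R v"
  proof (rule ccontr)
    assume "\<not> ?thesis"
    moreover have "(\<lambda>j. (b * (1/2) ^ j) *\<^sub>R v) \<longlonglongrightarrow> (b * 0) *\<^sub>R v"
      by (intro tendsto_intros LIMSEQ_realpow_zero) auto
    ultimately have "u \<preceq> (b * 0) *\<^sub>R v" by (intro le_limit[OF tendsto_const]) auto
    from phi_mono[OF this] phi_interior[OF u_interior] show False by (simp add: linear_0[OF linear_phi])
  qed
  then obtain j where j: "\<not> u \<preceq> (b * (1/2) ^ j) *\<^sub>R v" "\<And>i. i < j \<Longrightarrow> u \<preceq> (b * (1/2) ^ i) *\<^sub>R v"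
    using exists_least_iff[of "\<lambda>j. \<not> u \<preceq> (b * (1/2) ^ j) *\<^sub>R v"] by blast
  with b(2) obtain i where "j = Suc i" by (cases j) auto
  with j b(1) show ?thesis by (intro exI[of _ "b * (1/2) ^ i"]) auto
qed

text \<open>The set used here is the zero set, in the slice, of the sublinear function that would
  arise as a limit of \<open>M(y, v\<^sub>n) / M(u, v\<^sub>n)\<close>, where \<open>M(y, v)\<close> is the least \<open>b \<ge> 0\<close> with
  \<open>y \<preceq> b v\<close>.  This function is positive on the interior and does not increase under \<open>f\<close>, so it
  tends to zero along the normalised orbits.  The definition by \<open>\<forall>\<^sub>F\<close> avoids the passage to the limit.\<close>

lemma convex_attractor_if_unbounded:
  assumes x0: "x0 \<in> interior C" "filterlim (\<lambda>k. norm ((f ^^ k) x0)) at_top sequentially"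
  shows "\<exists>\<Omega>. convex \<Omega> \<and> \<Omega> \<subseteq> slice_boundary C \<phi> \<and>
    (\<forall>x\<in>open_slice C \<phi>. orbit_accumulation_points (normalized_map \<phi> f) x \<subseteq> \<Omega>)"
proof -
  define l where "l n = 1 + inverse (real (Suc n))" for n
  have l: "l n > 1" for n by (simp add: l_def)
  have l_lim: "l \<longlonglongrightarrow> 1"
    unfolding l_def using tendsto_add[OF tendsto_const[of 1] LIMSEQ_inverse_real_of_nat] by simp
  have "\<exists>v\<in>interior C. f v \<preceq> l n *\<^sub>R v" for n
    using subeigenvalues_iff[of "l n"] l[of n] by (auto simp: subeigenvalues_def)
  then obtain v where v: "\<And>n. v n \<in> interior C" "\<And>n. f (v n) \<preceq> l n *\<^sub>R v n" by metis
  have "\<forall>n. \<exists>\<beta>>0. u \<preceq> \<beta> *\<^sub>R v n \<and> \<not> u \<preceq> (\<beta> / 2) *\<^sub>R v n"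
    using near_optimal_dilation v(1) by blast
  then obtain \<beta> where \<beta>: "\<And>n. \<beta> n > 0" "\<And>n. u \<preceq> \<beta> n *\<^sub>R v n" "\<And>n. \<not> u \<preceq> (\<beta> n / 2) *\<^sub>R v n"
    by metis
  define \<Omega> where "\<Omega> = {y \<in> C. \<phi> y = 1 \<and> (\<forall>s>0. \<forall>\<^sub>F n in sequentially. y \<preceq> (s * \<beta> n) *\<^sub>R v n)}"
  have "convex \<Omega>"
  proof (rule convexI)
    fix y1 y2 and a b :: real
    assume y: "y1 \<in> \<Omega>" "y2 \<in> \<Omega>" and ab: "0 \<le> a" "0 \<le> b" "a + b = 1"
    have "\<forall>\<^sub>F n in sequentially. a *\<^sub>R y1 + b *\<^sub>R y2 \<preceq> (s * \<beta> n) *\<^sub>R v n" if "s > 0" for s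
    proof -
      have "\<forall>\<^sub>F n in sequentially. y1 \<preceq> (s * \<beta> n) *\<^sub>R v n" "\<forall>\<^sub>F n in sequentially. y2 \<preceq> (s * \<beta> n) *\<^sub>R v n"
        using y that by (auto simp: \<Omega>_def)
      then show ?thesis
      proof eventually_elim
        case (elim n)
        with ab have "a *\<^sub>R y1 + b *\<^sub>R y2 \<preceq> a *\<^sub>R ((s * \<beta> n) *\<^sub>R v n) + b *\<^sub>R ((s * \<beta> n) *\<^sub>R v n)"
          by (intro le_add le_scale)
        with ab(3) show ?case by (metis scaleR_left_distrib scaleR_one)
      qed
    qed
    moreover have "a *\<^sub>R y1 + b *\<^sub>R y2 \<in> C"
      using y ab by (intro add_in_cone scale_in_cone) (auto simp: \<Omega>_def)
    moreover have "\<phi> (a *\<^sub>R y1 + b *\<^sub>R y2) = 1"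
      using y ab by (simp add: \<Omega>_def phi_add phi_scale)
    ultimately show "a *\<^sub>R y1 + b *\<^sub>R y2 \<in> \<Omega>" unfolding \<Omega>_def by blast
  qed
  moreover have "\<Omega> \<subseteq> slice_boundary C \<phi>"
  proof
    fix y assume y: "y \<in> \<Omega>"
    show "y \<in> slice_boundary C \<phi>"
    proof (rule slice_boundaryI)
      show "y \<notin> interior C"
      proof
        assume "y \<in> interior C"
        then obtain a where a: "a > 0" "a *\<^sub>R u \<preceq> y" using interior_dominates_multiple by blast
        have "\<forall>\<^sub>F n in sequentially. y \<preceq> (a / 2 * \<beta> n) *\<^sub>R v n"
          using y half_gt_zero[OF a(1)] unfolding \<Omega>_def by blast
        then obtain n where "y \<preceq> (a / 2 * \<beta> n) *\<^sub>R v n"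
          using eventually_happens'[OF sequentially_bot] by blast
        with a(2) have "a *\<^sub>R u \<preceq> (a / 2 * \<beta> n) *\<^sub>R v n" by (rule le_trans)
        from le_scale[OF this, of "1 / a"] a(1) have "u \<preceq> (\<beta> n / 2) *\<^sub>R v n" by simp
        with \<beta>(3) show False by blast
      qed
    qed (use y in \<open>auto simp: \<Omega>_def\<close>)
  qed
  moreover have "orbit_accumulation_points (normalized_map \<phi> f) x \<subseteq> \<Omega>" if x: "x \<in> open_slice C \<phi>" for x
  proof
    have x': "x \<in> interior C" "\<phi> x = 1" using x by (auto simp: open_slice_def)
    have ph: "\<phi> ((f ^^ j) x) > 0" for j using x' iter_interior phi_interior by blast
    fix y assume "y \<in> orbit_accumulation_points (normalized_map \<phi> f) x"
    then obtain k :: "nat \<Rightarrow> nat" where k: "filterlim k at_top sequentially"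
      and lim: "(\<lambda>i. (normalized_map \<phi> f ^^ k i) x) \<longlonglongrightarrow> y"
      by (auto simp: orbit_accumulation_points_def)
    obtain K where K: "K > 0" "\<And>y. y \<preceq> (K * norm y) *\<^sub>R u"
      using interior_dominates[OF u_interior] by blast
    have phi_top: "filterlim (\<lambda>j. \<phi> ((f ^^ j) x)) at_top sequentially"
    proof -
      obtain a where a: "a > 0" "a *\<^sub>R x0 \<preceq> x" using interior_dominates_multiple[OF x'(1)] by blast
      obtain b where b: "b > 0" "\<And>y. y \<in> C \<Longrightarrow> norm y \<le> b * \<phi> y" using phi_coercive by blast
      have "(a / b) * norm ((f ^^ j) x0) \<le> \<phi> ((f ^^ j) x)" for j
      proof -
        have "a *\<^sub>R (f ^^ j) x0 \<preceq> (f ^^ j) x"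
          using iter_le[OF interior_scale[OF x0(1) a(1)] a(2)] by (simp add: iter_scale x0 a)
        from phi_mono[OF this] have "a * \<phi> ((f ^^ j) x0) \<le> \<phi> ((f ^^ j) x)" by (simp add: phi_scale)
        moreover have "norm ((f ^^ j) x0) / b \<le> \<phi> ((f ^^ j) x0)"
          using b(2)[OF interior_in_cone[OF iter_interior[OF x0(1), of j]]] b(1) by (simp add: field_simps)
        ultimately show ?thesis using a(1)
          by (smt (verit, best) mult_left_mono times_divide_eq_left times_divide_eq_right)
      qed
      moreover have "filterlim (\<lambda>j. (a / b) * norm ((f ^^ j) x0)) at_top sequentially"
        using a(1) b(1) by (intro filterlim_tendsto_pos_mult_at_top[OF tendsto_const _ x0(2)]) simp
      ultimately show ?thesis by (auto intro: filterlim_at_top_mono)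
    qed
    have "\<forall>\<^sub>F n in sequentially. y \<preceq> (s * \<beta> n) *\<^sub>R v n" if s: "s > 0" for s
    proof -
      define M where "M = K * norm x"
      have "x \<noteq> 0" using x' linear_0[OF linear_phi] by auto
      then have M: "M > 0" using K(1) by (simp add: M_def)
      have "\<forall>\<^sub>F i in sequentially. 4 * M / s \<le> \<phi> ((f ^^ k i) x)"
        using filterlim_compose[OF phi_top k] by (simp add: filterlim_at_top)
      moreover have "\<forall>\<^sub>F i in sequentially. dist ((normalized_map \<phi> f ^^ k i) x) y < s / (2 * K)"
        using tendstoD[OF lim] s K(1) by simp
      ultimately have "\<forall>\<^sub>F i in sequentially. 4 * M / s \<le> \<phi> ((f ^^ k i) x)
          \<and> dist ((normalized_map \<phi> f ^^ k i) x) y < s / (2 * K)"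
        by (rule eventually_conj)
      then obtain j where j: "4 * M / s \<le> \<phi> ((f ^^ j) x)"
        "dist ((normalized_map \<phi> f ^^ j) x) y < s / (2 * K)"
        using eventually_happens'[OF sequentially_bot] by blast
      define p where "p = \<phi> ((f ^^ j) x)"
      have p: "p > 0" "M / p \<le> s / 4"
        using j(1) ph[of j] s by (auto simp: p_def field_simps)
      have "y - (f ^^ j) x /\<^sub>R p \<preceq> (s / 2) *\<^sub>R u"
      proof (rule le_trans[OF K(2) le_scale_left])
        show "K * norm (y - (f ^^ j) x /\<^sub>R p) \<le> s / 2"
          using j(2) K(1) x' by (simp add: normalized_map_iter p_def dist_norm norm_minus_commute field_simps)
      qed (simp add: interior_in_cone u_interior)
      from le_add[OF this le_refl[of "(f ^^ j) x /\<^sub>R p"]]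
      have y_le: "y \<preceq> (s / 2) *\<^sub>R u + (f ^^ j) x /\<^sub>R p" by simp
      have "(\<lambda>n. l n ^ j) \<longlonglongrightarrow> 1 ^ j" by (intro tendsto_power l_lim)
      then have "\<forall>\<^sub>F n in sequentially. l n ^ j < 2" by (rule order_tendstoD) simp
      then show ?thesis
      proof eventually_elim
        case (elim n)
        have "x \<preceq> (M * \<beta> n) *\<^sub>R v n"
          using le_trans[OF K(2)[of x] le_scale[OF \<beta>(2)[of n], of "K * norm x"]] M by (simp add: M_def)
        then have "(f ^^ j) x \<preceq> (M * \<beta> n) *\<^sub>R (f ^^ j) (v n)"
          using M \<beta>(1) by (intro iter_le_scale x' v) auto
        also have "\<dots> \<preceq> (M * \<beta> n) *\<^sub>R (l n ^ j *\<^sub>R v n)"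
          using iter_of_subeigenvector[of "v n" "l n" 1 j] v l[of n] M \<beta>(1)[of n] by (intro le_scale) auto
        also have "\<dots> \<preceq> (M * \<beta> n * 2) *\<^sub>R v n"
          unfolding scaleR_scaleR using elim M \<beta>(1)[of n]
          by (intro le_scale_left mult_left_mono interior_in_cone v) auto
        finally have "(f ^^ j) x /\<^sub>R p \<preceq> ((M * \<beta> n * 2) *\<^sub>R v n) /\<^sub>R p"
          using p(1) by (intro le_scale) auto
        also have "\<dots> \<preceq> (s / 2 * \<beta> n) *\<^sub>R v n"
          unfolding scaleR_scaleR
        proof (rule le_scale_left)
          have "2 * \<beta> n * (M / p) \<le> 2 * \<beta> n * (s / 4)"
            using p(2) \<beta>(1)[of n] by (intro mult_left_mono) auto
          then show "inverse p * (M * \<beta> n * 2) \<le> s / 2 * \<beta> n" by (simp add: field_simps)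
        qed (simp add: interior_in_cone v)
        finally have "(f ^^ j) x /\<^sub>R p \<preceq> (s / 2 * \<beta> n) *\<^sub>R v n" .
        moreover have "(s / 2) *\<^sub>R u \<preceq> (s / 2 * \<beta> n) *\<^sub>R v n"
          using le_scale[OF \<beta>(2)[of n], of "s / 2"] s by simp
        ultimately have "(s / 2) *\<^sub>R u + (f ^^ j) x /\<^sub>R p \<preceq> (s / 2 * \<beta> n) *\<^sub>R v n + (s / 2 * \<beta> n) *\<^sub>R v n"
          by (intro le_add)
        with y_le have "y \<preceq> (s / 2 * \<beta> n) *\<^sub>R v n + (s / 2 * \<beta> n) *\<^sub>R v n" by (rule le_trans)
        then show ?case by (simp flip: scaleR_left_distrib)
      qed
    qed
    then show "y \<in> \<Omega>" using accumulation_point_in_slice[OF x lim] by (simp add: \<Omega>_def)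
  qed
  ultimately show ?thesis by blast
qed

end

section \<open>Convex attractors on the boundary\<close>

theorem theorem1p2:
  fixes C :: "'a::real_normed_vector set"
    and \<phi> :: "'a \<Rightarrow> real"
    and f :: "'a \<Rightarrow> 'a"
  assumes findim: "\<exists>B :: 'a set. finite B \<and> span B = UNIV"
    and cone: "salient_cone C" "closed C" "interior C \<noteq> {}"
    and phi: "strictly_positive C \<phi>"
    and f_into: "f \<in> interior C \<rightarrow> interior C"
    and f_mono: "order_preserving_on C (interior C) f"
    and f_hom: "homogeneous_on (interior C) f"
    and no_fix: "\<not> (\<exists>x\<in>interior C. f x = x)"
    and radius: "partial_spectral_radius C f = 1"
    and x0: "\<exists>x0\<in>interior C.
      compact (closure (forward_orbit f x0)) \<or>
      filterlim (\<lambda>k. norm ((f ^^ k) x0)) at_top sequentially"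
  shows "\<exists>\<Omega>. convex \<Omega> \<and> \<Omega> \<subseteq> slice_boundary C \<phi> \<and>
    (\<forall>x\<in>open_slice C \<phi>. orbit_accumulation_points (normalized_map \<phi> f) x \<subseteq> \<Omega>)"
proof -
  obtain u where u: "u \<in> interior C" using cone(3) by blast
  \<comment> \<open>Homogeneity would make \<open>0\<close> a fixed point.\<close>
  have "0 \<notin> interior C"
  proof
    assume "0 \<in> interior C"
    then have "f (2 *\<^sub>R 0) = 2 *\<^sub>R f 0"
      using f_hom unfolding homogeneous_on_def by (meson zero_less_numeral)
    then have "f 0 = 0" by (simp add: scaleR_2)
    with \<open>0 \<in> interior C\<close> no_fix show False by blast
  qed
  then interpret spectral_radius_one C \<phi> u f
    by unfold_locales (use assms u in auto)
  obtain x0 where x0: "x0 \<in> interior C" and alt: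
    "compact (closure (forward_orbit f x0)) \<or> filterlim (\<lambda>k. norm ((f ^^ k) x0)) at_top sequentially"
    using x0 by blast
  from alt show ?thesis
  proof
    assume "compact (closure (forward_orbit f x0))"
    then have "bounded (forward_orbit f x0)"
      using bounded_subset[OF compact_imp_bounded closure_subset] by blast
    then obtain R where R: "\<And>k. norm ((f ^^ k) x0) \<le> R"
      by (auto simp: bounded_iff forward_orbit_def)
    show ?thesis
      by (intro exI[of _ minorants] conjI ballI convex_minorants
          convex_attractor_if_bounded[OF no_fix x0 R])
  next
    assume "filterlim (\<lambda>k. norm ((f ^^ k) x0)) at_top sequentially"
    then show ?thesis by (rule convex_attractor_if_unbounded[OF x0])
  qed
qed

end
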